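(* Let $\vec{A}\subseteq\mathbb{Z}^d$ be a VAS, let $\vec{p}$ be a configuration, and let $\alpha\in\vec{A}^*$ be a word that is reversible on $\vec{p}$. Then there exists a word $\alpha'\in\vec{A}^*$ that is reversible on $\vec{p}$, satisfies $\Delta(\alpha')=\Delta(\alpha)$, and $$|\alpha'|\leq 17d^2x^{15d^{d+2}},$$ where $x=(1+2\|\vec{A}\|_\infty)(1+\|\vec{p}\|_\infty+\|\Delta(\alpha)\|_\infty)$.
   Context: Fix $d\geq1$. Let $\star$ be a new symbol, $\mathbb{Z}_\star=\mathbb{Z}\cup\{\star\}$, $\mathbb{N}_\star=\mathbb{N}\cup\{\star\}$. For $I\subseteq\{1,\ldots,d\}$, $\mathbb{Z}_I^d$ is the set of $\vec{z}\in\mathbb{Z}_\star^d$ with $\{i\mid \vec{z}(i)=\star\}=I$, and $\mathbb{N}_I^d=\mathbb{Z}_I^d\cap\mathbb{N}_\star^d$. Arithmetic on $\mathbb{Z}_I^d$ is componentwise on the components outside $I$ (components in $I$ stay $\star$). For $L\subseteq\{1,\ldots,d\}$ and $\vec{z}\in\mathbb{Z}_I^d$, $\pi_L(\vec{z})\in\mathbb{Z}_{I\cup L}^d$ agrees with $\vec{z}$ outside $L$. For $\vec{z}\in\mathbb{Z}_I^d$, $\|\vec{z}\|_\infty=\max_{i\notin I}|\vec{z}(i)|$ (and $0$ if $I=\{1,\ldots,d\}$); for a finite set $\vec{Z}$, $\|\vec{Z}\|_\infty=\max_{\vec{z}\in\vec{Z}}\|\vec{z}\|_\infty$ ($0$ if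 empty). A VAS is a finite $\vec{A}\subseteq\mathbb{Z}^d$; a configuration is an element of some $\mathbb{N}_I^d$. For $\sigma=\vec{a}_1\cdots\vec{a}_k\in\vec{A}^*$, $\Delta(\sigma)=\sum_j\vec{a}_j\in\mathbb{Z}^d$ and $|\sigma|=k$. A run from $\vec{x}\in\mathbb{N}_I^d$ to $\vec{y}\in\mathbb{N}_I^d$ labelled by $\sigma$ is a sequence $\vec{c}_0,\ldots,\vec{c}_k\in\mathbb{N}_I^d$ with $\vec{c}_0=\vec{x}$, $\vec{c}_k=\vec{y}$, $\vec{c}_j=\vec{c}_{j-1}+\pi_I(\vec{a}_j)$; written $\vec{x}\xrightarrow{\sigma}\vec{y}$. A word $\alpha\in\vec{A}^*$ is reversible on a configuration $\vec{p}$ if there is $\beta\in\vec{A}^*$ with a run $\vec{p}\xrightarrow{\alpha\beta}\vec{p}$ and $\Delta(\alpha)+\Delta(\beta)=\vec{0}$. *)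

theory Defs
  imports "HOL-Analysis.Analysis"
begin

text \<open>The dimension is \<open>d = CARD('d)\<close>, and the coordinates are the elements of the finite type
  \<open>'d\<close>. The symbol \<open>\<star>\<close> is \<open>None\<close>, so \<open>int option\<close> is \<open>\<int> \<union> {\<star>}\<close>.\<close>

type_synonym 'd starvec = "(int option) ^ 'd"

definition stars :: "'d::finite starvec \<Rightarrow> 'd set" where
  "stars z = {i. z $ i = None}"

definition Zstar :: "'d::finite set \<Rightarrow> 'd starvec set" where
  "Zstar I = {z. stars z = I}"

definition Nstar :: "'d::finite set \<Rightarrow> 'd starvec set" where
  "Nstar I = {z \<in> Zstar I. \<forall>i n. z $ i = Some n \<longrightarrow> 0 \<le> n}"

definition configuration :: "'d::finite starvec \<Rightarrow> bool" where
  "configuration p \<longleftrightarrow> (\<exists>I. p \<in> Nstar I)"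

text \<open>The identification of \<open>\<int>\<^sup>d\<close> with \<open>Zstar {}\<close>.\<close>

definition of_vec :: "int ^ 'd \<Rightarrow> 'd::finite starvec" where
  "of_vec a = (\<chi> i. Some (a $ i))"

definition proj :: "'d set \<Rightarrow> 'd::finite starvec \<Rightarrow> 'd starvec" where
  "proj L z = (\<chi> i. if i \<in> L then None else z $ i)"

text \<open>Only meant for two summands from the same \<open>Zstar I\<close>.\<close>

definition star_add :: "'d::finite starvec \<Rightarrow> 'd starvec \<Rightarrow> 'd starvec" (infixl "\<oplus>\<^sub>\<star>" 65) where
  "y \<oplus>\<^sub>\<star> z =
     (\<chi> i. case (y $ i, z $ i) of (Some m, Some n) \<Rightarrow> Some (m + n) | _ \<Rightarrow> None)"

definition star_norm :: "'d::finite starvec \<Rightarrow> nat" where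
  "star_norm z =
     (if stars z = UNIV then 0 else Max ((\<lambda>i. nat \<bar>the (z $ i)\<bar>) ` (- stars z)))"

definition vec_norm :: "int ^ 'd::finite \<Rightarrow> nat" where
  "vec_norm a = star_norm (of_vec a)"

definition set_norm :: "(int ^ 'd::finite) set \<Rightarrow> nat" where
  "set_norm A = (if A = {} then 0 else Max (vec_norm ` A))"

definition displacement :: "(int ^ 'd::finite) list \<Rightarrow> int ^ 'd" where
  "displacement \<sigma> = sum_list \<sigma>"

definition run :: "'d::finite starvec \<Rightarrow> (int ^ 'd) list \<Rightarrow> 'd starvec \<Rightarrow> bool" where
  "run x \<sigma> y \<longleftrightarrow>
     (\<exists>I c. (\<forall>j\<le>length \<sigma>. c j \<in> Nstar I) \<and> c 0 = x \<and> c (length \<sigma>) = y \<and>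
            (\<forall>j<length \<sigma>. c (Suc j) = c j \<oplus>\<^sub>\<star> proj I (of_vec (\<sigma> ! j))))"

definition reversible :: "(int ^ 'd::finite) set \<Rightarrow> 'd starvec \<Rightarrow> (int ^ 'd) list \<Rightarrow> bool" where
  "reversible A p \<alpha> \<longleftrightarrow>
     (\<exists>\<beta>\<in>lists A. run p (\<alpha> @ \<beta>) p \<and> displacement \<alpha> + displacement \<beta> = 0)"

end

theory Submission
  imports Defs
begin

text \<open>Dropping the starred components turns a configuration into an integer vector whose components
  in a set \<open>C\<close> have to stay nonnegative. Let \<open>p\<close> be the given configuration, \<open>q = p + \<Delta>(\<alpha>)\<close>, and let
  \<open>S\<close> be the set of configurations mutually reachable with \<open>p\<close>, displacements included. Choose a
  maximal \<open>J \<subseteq> C\<close> such that all components in \<open>J\<close> stay below a threshold depending on \<open>|J|\<close> throughout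
  \<open>S\<close>. By Rackoff's argument, short words \<open>u\<close> (fired from \<open>p\<close>) and, by reversing time, \<open>v\<close> (leading to
  \<open>q\<close>) leave the components in \<open>J\<close> unchanged while \<open>u\<close> increases and \<open>v\<close> decreases all components
  in \<open>C - J\<close>.

  Projected to \<open>J\<close>, the set \<open>S\<close> has few elements, and the displacements of its closed walks form a
  group, because every transition inside \<open>S\<close> can be undone inside \<open>S\<close>. The Steinitz lemma bounds the
  number of short cycles needed to realise a given displacement, so there are short walks \<open>\<pi>\<close> from \<open>p\<close>
  to \<open>q\<close> with displacement \<open>q - p\<close> and \<open>\<theta>\<close> around \<open>q\<close> with displacement \<open>- \<Delta>(u) - \<Delta>(v)\<close>. For large
  \<open>m\<close> the word \<open>u\<^sup>m \<pi> \<theta>\<^sup>m v\<^sup>m\<close> can be fired from \<open>p\<close> and has displacement \<open>\<Delta>(\<alpha>)\<close>; the old return word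
  then shows that it is reversible.\<close>

section \<open>The Steinitz lemma\<close>

text \<open>\<open>dependent\<close> speaks of sets, so a family that repeats a vector is a case of
  its own: there the difference of two equal members is the relation.\<close>

lemma linear_relation:
  fixes v :: "'i \<Rightarrow> 'a::euclidean_space"
  assumes "finite F" "DIM('a) < card F"
  shows "\<exists>c. (\<exists>i\<in>F. c i \<noteq> 0) \<and> (\<Sum>i\<in>F. c i *\<^sub>R v i) = 0"
proof (cases "inj_on v F")
  case True
  then have "dependent (v ` F)"
    using assms by (intro dependent_biggerset) (simp_all add: card_image)
  then obtain u w where "w \<in> v ` F" "u w \<noteq> 0" "(\<Sum>x\<in>v ` F. u x *\<^sub>R x) = 0"
    using assms(1) by (auto simp: dependent_finite)
  with True show ?thesis
    by (intro exI[of _ "u \<circ> v"]) (auto simp: sum.reindex)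
next
  case False
  then obtain i j where ij: "i \<in> F" "j \<in> F" "i \<noteq> j" "v i = v j"
    by (auto simp: inj_on_def)
  define c :: "'i \<Rightarrow> real" where "c k = (if k = i then 1 else 0) - (if k = j then 1 else 0)" for k
  have "(\<Sum>k\<in>F. c k *\<^sub>R v k)
      = (\<Sum>k\<in>F. if k = i then v k else 0) - (\<Sum>k\<in>F. if k = j then v k else 0)"
    unfolding sum_subtractf[symmetric] by (rule sum.cong) (auto simp: c_def)
  also have "\<dots> = 0"
    using ij assms(1) by simp
  finally show ?thesis
    using ij by (intro exI[of _ c]) (auto simp: c_def)
qed

text \<open>On the way from an interior point of the unit cube in the direction \<open>c\<close>,
  coordinate \<open>i\<close> alone would reach its face at time \<open>r i\<close>;
  \<open>t\<close> is the first of these times.\<close>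

lemma move_to_boundary:
  fixes \<mu> c :: "'i \<Rightarrow> real"
  assumes "finite F" "\<And>i. i \<in> F \<Longrightarrow> 0 < \<mu> i \<and> \<mu> i < 1" "\<exists>i\<in>F. c i \<noteq> 0"
  shows "\<exists>t. (\<forall>i\<in>F. 0 \<le> \<mu> i + t * c i \<and> \<mu> i + t * c i \<le> 1)
           \<and> (\<exists>i\<in>F. \<mu> i + t * c i = 0 \<or> \<mu> i + t * c i = 1)"
proof -
  define F' where "F' = {i \<in> F. c i \<noteq> 0}"
  define r where "r i = (if c i > 0 then (1 - \<mu> i) / c i else \<mu> i / (- c i))" for i
  define t where "t = Min (r ` F')"
  have F': "finite F'" "F' \<noteq> {}"
    using assms by (auto simp: F'_def)
  then have "t \<in> r ` F'"
    unfolding t_def by (intro Min_in) auto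
  then obtain i0 where i0: "i0 \<in> F" "c i0 \<noteq> 0" "t = r i0"
    by (auto simp: F'_def)
  have "r i > 0" if "i \<in> F'" for i
    using that assms(2)[of i] by (auto simp: r_def F'_def divide_pos_neg)
  with \<open>t \<in> r ` F'\<close> have "t > 0" by auto
  have "0 \<le> \<mu> i + t * c i \<and> \<mu> i + t * c i \<le> 1" if i: "i \<in> F" for i
  proof (cases "c i = 0")
    case False
    then have "t \<le> r i"
      unfolding t_def using F' i by (intro Min_le) (auto simp: F'_def)
    show ?thesis
    proof (cases "c i > 0")
      case True
      with \<open>t \<le> r i\<close> have "t * c i \<le> 1 - \<mu> i"
        by (simp add: r_def pos_le_divide_eq)
      moreover have "t * c i > 0" using True \<open>t > 0\<close> by simp
      ultimately show ?thesis using assms(2)[OF i] by linarith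
    next
      case neg: False
      with False have "c i < 0" by simp
      moreover have "t \<le> \<mu> i / (- c i)"
        using \<open>t \<le> r i\<close> neg by (simp only: r_def if_False)
      ultimately have "t * (- c i) \<le> \<mu> i"
        by (metis neg_0_less_iff_less pos_le_divide_eq)
      moreover have "t * (- c i) > 0" using \<open>c i < 0\<close> \<open>t > 0\<close> by (simp add: mult_pos_neg)
      ultimately show ?thesis using assms(2)[OF i] by (simp)
    qed
  qed (use assms(2)[OF i] in auto)
  moreover have "\<mu> i0 + t * c i0 = 0 \<or> \<mu> i0 + t * c i0 = 1"
    using i0 by (auto simp: r_def)
  ultimately show ?thesis using i0 by blast
qed

text \<open>The vertex argument for the polytope of weights with a prescribed weighted sum: more
  than \<open>DIM('a)\<close> fractional weights admit a linear relation among their vectors, and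
  moving along it until a weight becomes 0 or 1 keeps the sum and leaves fewer fractional
  weights.\<close>

lemma few_fractional:
  fixes v :: "'i \<Rightarrow> 'a::euclidean_space" and \<omega> :: "'i \<Rightarrow> real"
  assumes "finite I" "\<And>i. i \<in> I \<Longrightarrow> 0 \<le> \<omega> i \<and> \<omega> i \<le> 1"
  shows "\<exists>\<mu>. (\<forall>i\<in>I. 0 \<le> \<mu> i \<and> \<mu> i \<le> 1) \<and> (\<Sum>i\<in>I. \<mu> i *\<^sub>R v i) = (\<Sum>i\<in>I. \<omega> i *\<^sub>R v i)
           \<and> card {i \<in> I. 0 < \<mu> i \<and> \<mu> i < 1} \<le> DIM('a)"
  using assms(2)
proof (induction "card {i \<in> I. 0 < \<omega> i \<and> \<omega> i < 1}" arbitrary: \<omega> rule: less_induct)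
  case less
  define F where "F = {i \<in> I. 0 < \<omega> i \<and> \<omega> i < 1}"
  show ?case
  proof (cases "card F \<le> DIM('a)")
    case True
    with less.prems show ?thesis unfolding F_def by blast
  next
    case False
    have "finite F" "F \<subseteq> I" using assms(1) by (auto simp: F_def)
    obtain c where c: "\<exists>i\<in>F. c i \<noteq> 0" "(\<Sum>i\<in>F. c i *\<^sub>R v i) = 0"
      using linear_relation[OF \<open>finite F\<close>, of v] False by auto
    obtain t where t: "\<And>i. i \<in> F \<Longrightarrow> 0 \<le> \<omega> i + t * c i \<and> \<omega> i + t * c i \<le> 1"
      and hit: "\<exists>i\<in>F. \<omega> i + t * c i = 0 \<or> \<omega> i + t * c i = 1"
      using move_to_boundary[OF \<open>finite F\<close>, of \<omega> c] c by (auto simp: F_def)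
    define \<mu> where "\<mu> i = \<omega> i + (if i \<in> F then t * c i else 0)" for i
    have \<mu>: "0 \<le> \<mu> i \<and> \<mu> i \<le> 1" if "i \<in> I" for i
      using t less.prems that by (auto simp: \<mu>_def)
    have "{i \<in> I. 0 < \<mu> i \<and> \<mu> i < 1} \<subset> F"
    proof
      show "{i \<in> I. 0 < \<mu> i \<and> \<mu> i < 1} \<subseteq> F"
        by (auto simp: \<mu>_def F_def split: if_splits)
      show "{i \<in> I. 0 < \<mu> i \<and> \<mu> i < 1} \<noteq> F"
        using hit by (force simp: \<mu>_def)
    qed
    then have "card {i \<in> I. 0 < \<mu> i \<and> \<mu> i < 1} < card {i \<in> I. 0 < \<omega> i \<and> \<omega> i < 1}"
      using \<open>finite F\<close> unfolding F_def[symmetric] by (rule psubset_card_mono[rotated])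
    from less.hyps[OF this \<mu>] obtain \<nu> where \<nu>: "\<forall>i\<in>I. 0 \<le> \<nu> i \<and> \<nu> i \<le> 1"
      "(\<Sum>i\<in>I. \<nu> i *\<^sub>R v i) = (\<Sum>i\<in>I. \<mu> i *\<^sub>R v i)"
      "card {i \<in> I. 0 < \<nu> i \<and> \<nu> i < 1} \<le> DIM('a)" by auto
    have "(\<Sum>i\<in>I. \<mu> i *\<^sub>R v i)
        = (\<Sum>i\<in>I. \<omega> i *\<^sub>R v i) + (\<Sum>i\<in>I. if i \<in> F then (t * c i) *\<^sub>R v i else 0)"
      unfolding sum.distrib[symmetric]
      by (rule sum.cong) (auto simp: \<mu>_def scaleR_add_left)
    also have "(\<Sum>i\<in>I. if i \<in> F then (t * c i) *\<^sub>R v i else 0) = (\<Sum>i\<in>F. (t * c i) *\<^sub>R v i)"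
      using \<open>F \<subseteq> I\<close> assms(1) by (simp add: sum.If_cases Int_absorb1)
    also have "\<dots> = t *\<^sub>R (\<Sum>i\<in>F. c i *\<^sub>R v i)"
      by (simp add: scaleR_sum_right)
    finally show ?thesis using \<nu> c(2) by auto
  qed
qed

lemma abs_sum_list_component:
  fixes v :: "'i \<Rightarrow> real ^ 'd" and b :: real
  assumes "\<And>i. i \<in> set xs \<Longrightarrow> \<bar>v i $ k\<bar> \<le> b"
  shows "\<bar>(\<Sum>i\<leftarrow>xs. v i) $ k\<bar> \<le> length xs * b"
  using assms
proof (induction xs)
  case (Cons i xs)
  then have "\<bar>v i $ k\<bar> \<le> b" "\<bar>(\<Sum>i\<leftarrow>xs. v i) $ k\<bar> \<le> length xs * b" by auto
  then have "\<bar>v i $ k + (\<Sum>i\<leftarrow>xs. v i) $ k\<bar> \<le> b + length xs * b" by linarith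
  then show ?case by (simp add: algebra_simps)
qed simp

text \<open>The Grinberg--Sevastyanov argument: a point of the weight polytope with few fractional
  coordinates has a zero coordinate, and that vector is put last.\<close>

lemma steinitz_weights:
  fixes v :: "'i \<Rightarrow> real ^ 'd" and \<omega> :: "'i \<Rightarrow> real" and b :: real
  assumes "finite I" "\<And>i k. i \<in> I \<Longrightarrow> \<bar>v i $ k\<bar> \<le> b" "0 \<le> b"
    and "CARD('d) \<le> card I"
    and "\<And>i. i \<in> I \<Longrightarrow> 0 \<le> \<omega> i \<and> \<omega> i \<le> 1"
    and "(\<Sum>i\<in>I. \<omega> i) = real (card I) - CARD('d)"
    and "(\<Sum>i\<in>I. \<omega> i *\<^sub>R v i) = (real (card I) - CARD('d)) *\<^sub>R t"
  shows "\<exists>xs. distinct xs \<and> set xs = I \<and>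
           (\<forall>j\<le>length xs. \<forall>k. \<bar>(\<Sum>i\<leftarrow>take j xs. v i) $ k\<bar> \<le> CARD('d) * b + card I * \<bar>t $ k\<bar>)"
  using assms
proof (induction "card I - CARD('d)" arbitrary: I \<omega>)
  case 0
  then have "card I = CARD('d)" by simp
  obtain xs where xs: "set xs = I" "distinct xs"
    using finite_distinct_list[OF \<open>finite I\<close>] by blast
  have "\<bar>(\<Sum>i\<leftarrow>take j xs. v i) $ k\<bar> \<le> CARD('d) * b + card I * \<bar>t $ k\<bar>"
    if "j \<le> length xs" for j k
  proof -
    have "\<bar>(\<Sum>i\<leftarrow>take j xs. v i) $ k\<bar> \<le> length (take j xs) * b"
      using "0.prems"(2) xs by (intro abs_sum_list_component) (auto dest: in_set_takeD)
    also have "\<dots> \<le> CARD('d) * b"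
      using that xs \<open>card I = CARD('d)\<close> \<open>0 \<le> b\<close> distinct_card[OF xs(2)]
      by (intro mult_right_mono) auto
    finally show ?thesis by (simp add: add_increasing2)
  qed
  with xs show ?case by blast
next
  case (Suc l)
  define D where "D = CARD('d)"
  define r where "r = real (card I) - D"
  have r: "r \<ge> 1" using Suc.hyps(2) by (simp add: r_def D_def)
  have D: "CARD('d) = D" by (simp add: D_def)
  \<comment> \<open>Scaling makes the total weight \<open>r - 1\<close> and the weighted sum
    \<open>(r - 1) *\<^sub>R t\<close>, the values required once one vector has been removed from
    \<open>I\<close>.\<close>
  define \<mu> where "\<mu> i = (r - 1) / r * \<omega> i" for i
  have "0 \<le> (r - 1) / r" "(r - 1) / r \<le> 1" using r by auto
  then have \<mu>01: "0 \<le> \<mu> i \<and> \<mu> i \<le> 1" if "i \<in> I" for i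
    using Suc.prems(5)[OF that] unfolding \<mu>_def by (intro conjI mult_nonneg_nonneg mult_le_one) auto
  \<comment> \<open>The additional coordinate 1 makes the total weight part of the preserved sum;
    the dimension, and with it the bound on the number of fractional weights, becomes
    \<open>D + 1\<close>.\<close>
  obtain \<nu> where \<nu>01: "\<And>i. i \<in> I \<Longrightarrow> 0 \<le> \<nu> i \<and> \<nu> i \<le> 1"
    and \<nu>sum: "(\<Sum>i\<in>I. \<nu> i *\<^sub>R (v i, 1::real)) = (\<Sum>i\<in>I. \<mu> i *\<^sub>R (v i, 1))"
    and \<nu>frac: "card {i \<in> I. 0 < \<nu> i \<and> \<nu> i < 1} \<le> D + 1"
    using few_fractional[where \<omega> = \<mu> and v = "\<lambda>i. (v i, 1::real)", OF \<open>finite I\<close> \<mu>01] D by auto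
  have "(\<Sum>i\<in>I. \<nu> i) = (\<Sum>i\<in>I. \<mu> i)"
    using arg_cong[OF \<nu>sum, of snd] by (simp add: snd_sum)
  also have "\<dots> = (r - 1) / r * (\<Sum>i\<in>I. \<omega> i)"
    unfolding \<mu>_def by (rule sum_distrib_left[symmetric])
  also have "(\<Sum>i\<in>I. \<omega> i) = r"
    using Suc.prems(6) by (simp add: r_def D)
  also have "(r - 1) / r * r = r - 1" using r by simp
  finally have \<nu>1: "(\<Sum>i\<in>I. \<nu> i) = r - 1" .
  have "(\<Sum>i\<in>I. \<nu> i *\<^sub>R v i) = (\<Sum>i\<in>I. \<mu> i *\<^sub>R v i)"
    using arg_cong[OF \<nu>sum, of fst] by (simp add: fst_sum)
  also have "\<dots> = ((r - 1) / r) *\<^sub>R (\<Sum>i\<in>I. \<omega> i *\<^sub>R v i)"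
    by (simp add: \<mu>_def scaleR_sum_right)
  also have "\<dots> = ((r - 1) / r * r) *\<^sub>R t"
    using Suc.prems(7) by (simp add: r_def D)
  also have "\<dots> = (r - 1) *\<^sub>R t" using r by simp
  finally have \<nu>v: "(\<Sum>i\<in>I. \<nu> i *\<^sub>R v i) = (r - 1) *\<^sub>R t" .
  \<comment> \<open>If no weight vanished, all weights outside \<open>F\<close> would be 1 and those
    in \<open>F\<close> would add up to \<open>card F - D - 1\<close>, which is at most 0.
    Positivity of the weights in \<open>F\<close> then forces \<open>F = {}\<close>, and the empty
    sum would be \<open>- D - 1\<close>.\<close>
  have "\<exists>a\<in>I. \<nu> a = 0"
  proof (rule ccontr)
    assume no: "\<not> ?thesis"
    define F where "F = {i \<in> I. 0 < \<nu> i \<and> \<nu> i < 1}"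
    have F: "finite F" "F \<subseteq> I" using \<open>finite I\<close> by (auto simp: F_def)
    have one: "\<nu> i = 1" if "i \<in> I - F" for i
      using that no \<nu>01[of i] by (force simp: F_def)
    have "(\<Sum>i\<in>I. \<nu> i) = (\<Sum>i\<in>I - F. \<nu> i) + (\<Sum>i\<in>F. \<nu> i)"
      by (rule sum.subset_diff[OF F(2) \<open>finite I\<close>])
    also have "(\<Sum>i\<in>I - F. \<nu> i) = real (card I) - card F"
      using one F \<open>finite I\<close> by (simp add: card_Diff_subset of_nat_diff card_mono)
    finally have e: "(\<Sum>i\<in>F. \<nu> i) = real (card F) - D - 1"
      using \<nu>1 by (simp add: r_def)
    have "card F \<le> D + 1" using \<nu>frac by (simp add: F_def)
    then have "(\<Sum>i\<in>F. \<nu> i) \<le> 0" using e by simp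
    moreover have "(\<Sum>i\<in>F. \<nu> i) > 0" if "F \<noteq> {}"
      using F that by (intro sum_pos) (auto simp: F_def)
    ultimately have "F = {}" by force
    with e show False by simp
  qed
  then obtain a where a: "a \<in> I" "\<nu> a = 0" by blast
  have card: "card (I - {a}) = card I - 1" "card I \<ge> 1"
    using a \<open>finite I\<close> by (auto simp: card_gt_0_iff Suc_le_eq)
  have "\<exists>xs. distinct xs \<and> set xs = I - {a} \<and>
      (\<forall>j\<le>length xs. \<forall>k. \<bar>(\<Sum>i\<leftarrow>take j xs. v i) $ k\<bar>
         \<le> CARD('d) * b + card (I - {a}) * \<bar>t $ k\<bar>)"
  proof (rule Suc.hyps(1)[of _ \<nu>])
    show "l = card (I - {a}) - CARD('d)" "CARD('d) \<le> card (I - {a})"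
      using Suc.hyps(2) card by simp_all
    show "(\<Sum>i\<in>I - {a}. \<nu> i) = real (card (I - {a})) - CARD('d)"
      using \<nu>1 a card \<open>finite I\<close> by (simp add: sum_diff1 r_def D of_nat_diff)
    show "(\<Sum>i\<in>I - {a}. \<nu> i *\<^sub>R v i) = (real (card (I - {a})) - CARD('d)) *\<^sub>R t"
      using \<nu>v a card \<open>finite I\<close> by (simp add: sum_diff1 r_def D of_nat_diff algebra_simps)
  qed (use Suc.prems \<nu>01 in auto)
  then obtain xs where xs: "distinct xs" "set xs = I - {a}"
    and bd: "\<forall>j\<le>length xs. \<forall>k.
      \<bar>(\<Sum>i\<leftarrow>take j xs. v i) $ k\<bar> \<le> D * b + card (I - {a}) * \<bar>t $ k\<bar>"
    unfolding D by (elim exE conjE) (rule that)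
  define ys where "ys = xs @ [a]"
  have ys: "distinct ys" "set ys = I" using xs a by (auto simp: ys_def)
  \<comment> \<open>The only new prefix is the whole sum, since \<open>a\<close> comes last.
    Splitting each vector by \<open>1 - \<omega> i\<close> and \<open>\<omega> i\<close> yields a
    part of total weight \<open>D\<close> and the part \<open>r *\<^sub>R t\<close>.\<close>
  have full: "\<bar>(\<Sum>i\<in>I. v i) $ k\<bar> \<le> D * b + card I * \<bar>t $ k\<bar>" for k
  proof -
    have "(\<Sum>i\<in>I. v i) = (\<Sum>i\<in>I. (1 - \<omega> i) *\<^sub>R v i) + (\<Sum>i\<in>I. \<omega> i *\<^sub>R v i)"
      by (simp add: algebra_simps flip: sum.distrib)
    then have "(\<Sum>i\<in>I. v i) $ k = (\<Sum>i\<in>I. (1 - \<omega> i) * v i $ k) + r * t $ k"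
      using Suc.prems(7) by (simp add: r_def D)
    moreover have "\<bar>\<Sum>i\<in>I. (1 - \<omega> i) * v i $ k\<bar> \<le> (\<Sum>i\<in>I. (1 - \<omega> i) * b)"
      using Suc.prems(2,5)
      by (intro order.trans[OF sum_abs] sum_mono) (auto simp: abs_mult intro!: mult_mono)
    moreover have "(\<Sum>i\<in>I. (1 - \<omega> i) * b) = D * b"
      using Suc.prems(6) by (simp add: sum_subtractf D flip: sum_distrib_right)
    moreover have "\<bar>r * t $ k\<bar> \<le> card I * \<bar>t $ k\<bar>"
      using r unfolding abs_mult by (intro mult_right_mono) (auto simp: r_def)
    ultimately show ?thesis by linarith
  qed
  have "\<bar>(\<Sum>i\<leftarrow>take j ys. v i) $ k\<bar> \<le> D * b + card I * \<bar>t $ k\<bar>" if "j \<le> length ys" for j k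
  proof (cases "j \<le> length xs")
    case True
    have "real (card (I - {a})) * \<bar>t $ k\<bar> \<le> card I * \<bar>t $ k\<bar>"
      using card by (intro mult_right_mono) auto
    with bd[rule_format, OF True, of k] True show ?thesis by (simp add: ys_def)
  next
    case False
    with that have "take j ys = ys" by (simp add: ys_def)
    with full[of k] ys show ?thesis by (simp add: sum_list_distinct_conv_sum_set)
  qed
  with ys show ?case unfolding D by blast
qed

text \<open>The induction starts with all weights equal to (n - d)/n. Then \<open>t\<close> is the
  average of the vectors, and the error term n |t k| is the k-th component of their sum. Indices are
  ordered instead of vectors because \<open>vs\<close> may repeat a vector; fewer than d vectors may
  stay in any order.\<close>

lemma steinitz:
  fixes vs :: "(int ^ 'd) list"
  assumes "\<And>v k. v \<in> set vs \<Longrightarrow> \<bar>v $ k\<bar> \<le> int b"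
  shows "\<exists>ws. mset ws = mset vs \<and>
    (\<forall>j\<le>length ws. \<forall>k. \<bar>sum_list (take j ws) $ k\<bar> \<le> int (CARD('d) * b) + \<bar>sum_list vs $ k\<bar>)"
proof -
  define D where "D = CARD('d)"
  define n where "n = length vs"
  define f :: "int ^ 'd \<Rightarrow> real ^ 'd" where "f v = (\<chi> k. real_of_int (v $ k))" for v
  define v where "v i = f (vs ! i)" for i
  have f_sum: "(\<Sum>w\<leftarrow>ws. f w) = f (sum_list ws)" for ws
    by (induction ws) (auto simp: f_def vec_eq_iff)
  have v_sum: "(\<Sum>i\<leftarrow>xs. v i) = f (\<Sum>i\<leftarrow>xs. vs ! i)" for xs
    using f_sum[of "map ((!) vs) xs"] by (simp add: v_def o_def)
  have v_le: "\<bar>v i $ k\<bar> \<le> b" if "i < n" for i k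
    using assms[of "vs ! i" k] that unfolding v_def f_def n_def by simp
  have all: "(\<Sum>i<n. v i) = f (sum_list vs)"
    using v_sum[of "[0..<n]"] map_nth[of vs] by (simp add: n_def interv_sum_list_conv_sum_set_nat atLeast0LessThan)
  define good where "good xs \<longleftrightarrow> distinct xs \<and> set xs = {..<n} \<and>
    (\<forall>j\<le>length xs. \<forall>k. \<bar>(\<Sum>i\<leftarrow>take j xs. v i) $ k\<bar> \<le> D * b + \<bar>real_of_int (sum_list vs $ k)\<bar>)" for xs
  have "\<exists>xs. good xs"
  proof (cases "D \<le> n")
    case False
    have "\<bar>(\<Sum>i\<leftarrow>take j [0..<n]. v i) $ k\<bar> \<le> D * b + \<bar>real_of_int (sum_list vs $ k)\<bar>"
      if "j \<le> n" for j k
    proof -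
      have "\<bar>(\<Sum>i\<leftarrow>take j [0..<n]. v i) $ k\<bar> \<le> length (take j [0..<n]) * real b"
        using v_le by (intro abs_sum_list_component) (auto dest: in_set_takeD)
      also have "\<dots> \<le> real D * real b" using False that by (intro mult_right_mono) auto
      finally show ?thesis by simp
    qed
    then have "good [0..<n]" by (auto simp: good_def)
    then show ?thesis by blast
  next
    case True
    have "D > 0" by (simp add: D_def)
    with True have n: "n > 0" by simp
    define t where "t = (1 / n) *\<^sub>R f (sum_list vs)"
    have "\<exists>xs. distinct xs \<and> set xs = {..<n} \<and>
        (\<forall>j\<le>length xs. \<forall>k. \<bar>(\<Sum>i\<leftarrow>take j xs. v i) $ k\<bar> \<le> CARD('d) * real b + card {..<n} * \<bar>t $ k\<bar>)"
    proof (rule steinitz_weights[of _ _ _ "\<lambda>_. (real n - D) / n"])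
      show "(\<Sum>i<n. ((real n - D) / n) *\<^sub>R v i) = (real (card {..<n}) - CARD('d)) *\<^sub>R t"
        unfolding scaleR_sum_right[symmetric] all by (simp add: t_def D_def)
    qed (use True n v_le in \<open>auto simp: D_def\<close>)
    then obtain xs where "distinct xs" "set xs = {..<n}"
      "\<forall>j\<le>length xs. \<forall>k. \<bar>(\<Sum>i\<leftarrow>take j xs. v i) $ k\<bar> \<le> CARD('d) * real b + card {..<n} * \<bar>t $ k\<bar>"
      by (elim exE conjE) (rule that)
    moreover have "card {..<n} * \<bar>t $ k\<bar> = \<bar>real_of_int (sum_list vs $ k)\<bar>" for k
      using n by (simp add: t_def f_def abs_mult)
    ultimately have "good xs" by (simp add: good_def D_def)
    then show ?thesis by blast
  qed
  then obtain xs where xs: "good xs" by blast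
  define ws where "ws = map ((!) vs) xs"
  have "mset xs = mset [0..<n]"
    using xs by (subst set_eq_iff_mset_eq_distinct[symmetric]) (auto simp: good_def)
  then have "mset ws = mset (map ((!) vs) [0..<n])" unfolding ws_def mset_map by simp
  then have "mset ws = mset vs" by (simp add: n_def map_nth)
  moreover have "\<bar>sum_list (take j ws) $ k\<bar> \<le> int (CARD('d) * b) + \<bar>sum_list vs $ k\<bar>"
    if "j \<le> length ws" for j k
  proof -
    have "\<bar>f (sum_list (take j ws)) $ k\<bar> \<le> D * b + \<bar>real_of_int (sum_list vs $ k)\<bar>"
      using xs that unfolding good_def ws_def by (metis length_map take_map v_sum)
    then have "real_of_int \<bar>sum_list (take j ws) $ k\<bar>
        \<le> real_of_int (int (CARD('d) * b) + \<bar>sum_list vs $ k\<bar>)"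
      by (simp add: f_def D_def)
    then show ?thesis by (simp only: of_int_le_iff)
  qed
  ultimately show ?thesis by blast
qed

section \<open>Lattice points in a box and short sums\<close>

lemma card_int_box: "card {w :: int ^ 'd. \<forall>k. \<bar>w $ k\<bar> \<le> int B} \<le> (2 * B + 1) ^ CARD('d)"
  and finite_int_box: "finite {w :: int ^ 'd. \<forall>k. \<bar>w $ k\<bar> \<le> int B}"
proof -
  let ?X = "{w :: int ^ 'd. \<forall>k. \<bar>w $ k\<bar> \<le> int B}"
  let ?P = "(UNIV :: 'd set) \<rightarrow>\<^sub>E {- int B..int B}"
  have inj: "inj_on (\<lambda>w. ($) w) ?X" by (auto simp: inj_on_def vec_eq_iff)
  have "- int B \<le> w $ k \<and> w $ k \<le> int B" if "w \<in> ?X" for w k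
  proof -
    have "\<bar>w $ k\<bar> \<le> int B" using that by blast
    then show ?thesis by linarith
  qed
  then have sub: "(\<lambda>w. ($) w) ` ?X \<subseteq> ?P" by auto
  have fin: "finite ?P" by (intro finite_PiE) auto
  show "finite ?X" using finite_imageD[OF finite_subset[OF sub fin] inj] .
  have "card ?X = card ((\<lambda>w. ($) w) ` ?X)" using inj by (simp add: card_image)
  also have "\<dots> \<le> card ?P" by (rule card_mono[OF fin sub])
  also have "\<dots> = (2 * B + 1) ^ CARD('d)"
    by (simp add: card_PiE nat_add_distrib nat_mult_distrib algebra_simps mult_2)
  finally show "card ?X \<le> (2 * B + 1) ^ CARD('d)" .
qed

text \<open>In a shortest representation, reordered by \<open>steinitz\<close>, no partial sum can repeat.\<close>

lemma short_sum:
  fixes V :: "(int ^ 'd) set"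
  assumes "\<And>v k. v \<in> V \<Longrightarrow> \<bar>v $ k\<bar> \<le> int b" "vs \<in> lists V" "\<And>k. \<bar>sum_list vs $ k\<bar> \<le> int W"
  shows "\<exists>ws\<in>lists V. sum_list ws = sum_list vs \<and>
           length ws \<le> (2 * (CARD('d) * b + W) + 1) ^ CARD('d)"
proof -
  let ?P = "\<lambda>ws. ws \<in> lists V \<and> sum_list ws = sum_list vs"
  define us where "us = arg_min length ?P"
  have us: "?P us" and min: "\<And>ws. ?P ws \<Longrightarrow> length us \<le> length ws"
    using arg_min_nat_lemma[of ?P vs length] assms(2) by (auto simp: us_def)
  obtain ws where ws: "mset ws = mset us"
    and bd: "\<And>j k. j \<le> length ws \<Longrightarrow>
        \<bar>sum_list (take j ws) $ k\<bar> \<le> int (CARD('d) * b) + \<bar>sum_list us $ k\<bar>"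
    using steinitz[of us b] assms(1) us by (metis in_listsD)
  have wsV: "ws \<in> lists V" using us mset_eq_setD[OF ws] by (simp add: in_lists_conv_set)
  have wss: "sum_list ws = sum_list vs" using us by (simp add: ws flip: sum_mset_sum_list)
  have wsl: "length ws = length us" using mset_eq_length[OF ws] .
  let ?B = "CARD('d) * b + W"
  let ?g = "\<lambda>j. sum_list (take j ws)"
  have "inj_on ?g {..length ws}"
  proof (rule linorder_inj_onI')
    fix i j assume ij: "i \<in> {..length ws}" "j \<in> {..length ws}" "i < j"
    show "?g i \<noteq> ?g j"
    proof
      assume eq: "?g i = ?g j"
      let ?ws = "take i ws @ drop j ws"
      have "sum_list ?ws = sum_list (take j ws) + sum_list (drop j ws)" by (simp add: eq)
      also have "\<dots> = sum_list vs" by (simp add: wss flip: sum_list_append)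
      finally have "?P ?ws" using wsV by (auto dest: in_set_takeD in_set_dropD)
      from min[OF this] ij wsl show False by simp
    qed
  qed
  moreover have "?g ` {..length ws} \<subseteq> {w. \<forall>k. \<bar>w $ k\<bar> \<le> int ?B}"
  proof clarsimp
    fix j k assume "j \<le> length ws"
    from bd[OF this, of k] assms(3)[of k] us
    show "\<bar>sum_list (take j ws) $ k\<bar> \<le> int (CARD('d)) * int b + int W" by simp
  qed
  ultimately have "card {..length ws} \<le> card {w :: int ^ 'd. \<forall>k. \<bar>w $ k\<bar> \<le> int ?B}"
    using finite_int_box[of ?B] by (intro card_inj_on_le) auto
  with card_int_box[of ?B, where ?'d = 'd] have "length ws \<le> (2 * ?B + 1) ^ CARD('d)"
    by simp
  with wsV wss show ?thesis by blast
qed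

section \<open>Walks in projections of a set of configurations\<close>

text \<open>Projections are never formed: vectors keep all their components and are compared on
  \<open>B\<close> only, so no displacement is lost.\<close>

definition agree :: "'d set \<Rightarrow> int ^ 'd \<Rightarrow> int ^ 'd \<Rightarrow> bool" where
  "agree B x y \<longleftrightarrow> (\<forall>i\<in>B. x $ i = y $ i)"

lemma agree_refl [simp]: "agree B x x"
  by (simp add: agree_def)

lemma agree_sym: "agree B x y \<longleftrightarrow> agree B y x"
  by (auto simp: agree_def)

lemma agree_trans: "agree B x y \<Longrightarrow> agree B y z \<Longrightarrow> agree B x z"
  by (simp add: agree_def)

lemma agree_cong: "agree B x y \<Longrightarrow> agree B x z \<longleftrightarrow> agree B y z"
  "agree B x y \<Longrightarrow> agree B z x \<longleftrightarrow> agree B z y"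
  by (auto simp: agree_def)

lemma agree_add [simp]: "agree B (x + a) (y + a) \<longleftrightarrow> agree B x y"
  by (simp add: agree_def)

lemma agree_UNIV [simp]: "agree UNIV x y \<longleftrightarrow> x = y"
  by (auto simp: agree_def vec_eq_iff)

lemma agree_mono: "agree B x y \<Longrightarrow> B' \<subseteq> B \<Longrightarrow> agree B' x y"
  by (auto simp: agree_def)

lemma abs_sum_list_le:
  fixes \<sigma> :: "(int ^ 'd) list"
  assumes "\<And>v. v \<in> set \<sigma> \<Longrightarrow> \<bar>v $ i\<bar> \<le> int a"
  shows "\<bar>sum_list \<sigma> $ i\<bar> \<le> int (a * length \<sigma>)"
  using assms
proof (induction \<sigma>)
  case (Cons v \<sigma>)
  have "\<bar>v $ i + sum_list \<sigma> $ i\<bar> \<le> \<bar>v $ i\<bar> + \<bar>sum_list \<sigma> $ i\<bar>"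
    by (rule abs_triangle_ineq)
  also have "\<dots> \<le> int a + int (a * length \<sigma>)"
    using Cons by (intro add_mono) auto
  also have "\<dots> = int (a * length (v # \<sigma>))"
    by (simp add: distrib_left)
  finally show ?case by simp
qed simp

text \<open>A walk in the transition graph of \<open>S\<close> projected to \<open>B\<close>; the coordinates outside \<open>B\<close> are
  tracked to record displacements, but not constrained.\<close>

primrec walk :: "(int ^ 'd) set \<Rightarrow> (int ^ 'd) set \<Rightarrow> 'd set \<Rightarrow> int ^ 'd \<Rightarrow> (int ^ 'd) list \<Rightarrow> bool" where
  "walk A S B x [] \<longleftrightarrow> (\<exists>y\<in>S. agree B y x)"
| "walk A S B x (a # \<sigma>) \<longleftrightarrow>
     a \<in> A \<and> (\<exists>y\<in>S. y + a \<in> S \<and> agree B y x) \<and> walk A S B (x + a) \<sigma>"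

lemma walk_start: "walk A S B x \<sigma> \<Longrightarrow> \<exists>y\<in>S. agree B y x"
  by (cases \<sigma>) auto

lemma walk_append:
  "walk A S B x (\<sigma> @ \<tau>) \<longleftrightarrow> walk A S B x \<sigma> \<and> walk A S B (x + sum_list \<sigma>) \<tau>"
proof (induction \<sigma> arbitrary: x)
  case Nil
  then show ?case using walk_start by auto
next
  case (Cons a \<sigma>)
  then show ?case by (auto simp: add.assoc)
qed

lemma walk_take: "walk A S B x \<sigma> \<Longrightarrow> walk A S B x (take j \<sigma>)"
  by (metis append_take_drop_id walk_append)

lemma walk_end: "walk A S B x \<sigma> \<Longrightarrow> \<exists>y\<in>S. agree B y (x + sum_list \<sigma>)"
  using walk_start[of A S B "x + sum_list \<sigma>" "[]"] walk_append[of A S B x \<sigma> "[]"] by simp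

lemma walk_lists: "walk A S B x \<sigma> \<Longrightarrow> \<sigma> \<in> lists A"
  by (induction \<sigma> arbitrary: x) auto

lemma walk_mono: "walk A S B x \<sigma> \<Longrightarrow> B' \<subseteq> B \<Longrightarrow> walk A S B' x \<sigma>"
proof (induction \<sigma> arbitrary: x)
  case Nil
  then show ?case by (auto simp: agree_def)
next
  case (Cons a \<sigma>)
  then have "walk A S B' (x + a) \<sigma>" by simp
  moreover have "\<exists>y\<in>S. y + a \<in> S \<and> agree B' y x"
    using Cons.prems agree_mono[OF _ Cons.prems(2)] by auto
  ultimately show ?case using Cons.prems(1) by simp
qed

lemma walk_agree:
  assumes "agree B x y"
  shows "walk A S B x \<sigma> \<longleftrightarrow> walk A S B y \<sigma>"
  using assms
proof (induction \<sigma> arbitrary: x y)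
  case Nil
  then show ?case by (simp add: agree_cong(2)[OF Nil])
next
  case (Cons a \<sigma>)
  have "walk A S B (x + a) \<sigma> \<longleftrightarrow> walk A S B (y + a) \<sigma>"
    by (rule Cons.IH) (simp add: Cons.prems)
  then show ?case by (simp add: agree_cong(2)[OF Cons.prems])
qed

lemma walk_displacement_le:
  assumes "walk A S B x \<sigma>" "\<And>v. v \<in> A \<Longrightarrow> \<bar>v $ i\<bar> \<le> int a"
  shows "\<bar>sum_list \<sigma> $ i\<bar> \<le> int (a * length \<sigma>)"
  using walk_lists[OF assms(1)] assms(2) by (intro abs_sum_list_le) auto

text \<open>Time reversal: an edge from \<open>y\<close> to \<open>y + v\<close> inside
  \<open>S\<close>, read backwards, is an edge labelled \<open>- v\<close>. This is what turns
  results about leaving \<open>p\<close> into results about arriving at \<open>q\<close>.\<close>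

lemma walk_reverse_actions:
  assumes "walk A S B x \<sigma>"
  shows "walk (uminus ` A) S B (x + sum_list \<sigma>) (rev (map uminus \<sigma>))"
    and "sum_list (rev (map uminus \<sigma>)) = - sum_list \<sigma>"
proof -
  show "walk (uminus ` A) S B (x + sum_list \<sigma>) (rev (map uminus \<sigma>))"
    using assms
  proof (induction \<sigma> arbitrary: x)
    case (Cons a \<sigma>)
    then obtain y where y: "y \<in> S" "y + a \<in> S" "agree B y x" "a \<in> A" by auto
    have *: "x + (a + sum_list \<sigma>) + sum_list (rev (map uminus \<sigma>)) = x + a" for \<sigma> :: "(int ^ 'a) list"
      by (induction \<sigma>) (auto simp: algebra_simps)
    have "\<exists>z\<in>S. z + - a \<in> S \<and> agree B z (x + a)"
      using y by (intro bexI[of _ "y + a"]) auto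
    moreover have "\<exists>z\<in>S. agree B z (x + a + - a)"
      using y by auto
    ultimately have "walk (uminus ` A) S B (x + a) [- a]"
      using y by simp
    moreover have "walk (uminus ` A) S B (x + a + sum_list \<sigma>) (rev (map uminus \<sigma>))"
      using Cons by simp
    ultimately show ?case using *[of \<sigma>] by (simp add: walk_append add.assoc)
  qed simp
  show "sum_list (rev (map uminus \<sigma>)) = - sum_list \<sigma>"
    by (induction \<sigma>) auto
qed

text \<open>A shortest walk with a given goal does not visit the same projected configuration twice,
  and all configurations before its end lie in the box.\<close>

lemma shorten_walk:
  assumes "walk A S B x \<sigma>" "P (x + sum_list \<sigma>)"
    and P: "\<And>y z. agree B y z \<Longrightarrow> P y \<Longrightarrow> P z"
    and box: "\<And>y i. y \<in> S \<Longrightarrow> i \<in> B \<Longrightarrow> \<not> P y \<Longrightarrow> 0 \<le> y $ i \<and> y $ i < int l"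
  shows "\<exists>\<tau>. walk A S B x \<tau> \<and> P (x + sum_list \<tau>) \<and> length \<tau> \<le> l ^ card B"
proof -
  let ?Q = "\<lambda>\<tau>. walk A S B x \<tau> \<and> P (x + sum_list \<tau>)"
  define \<tau> where "\<tau> = arg_min length ?Q"
  have \<tau>: "?Q \<tau>" and min: "\<And>\<tau>'. ?Q \<tau>' \<Longrightarrow> length \<tau> \<le> length \<tau>'"
    using arg_min_nat_lemma[of ?Q \<sigma> length] assms(1,2) by (auto simp: \<tau>_def)
  let ?c = "\<lambda>j. x + sum_list (take j \<tau>)"
  let ?g = "\<lambda>j. restrict (($) (?c j)) B"
  have "inj_on ?g {..<length \<tau>}"
  proof (rule linorder_inj_onI')
    fix i j assume ij: "i \<in> {..<length \<tau>}" "j \<in> {..<length \<tau>}" "i < j"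
    show "?g i \<noteq> ?g j"
    proof
      assume eq: "?g i = ?g j"
      then have ag: "agree B (?c j) (?c i)"
        unfolding agree_def by (metis restrict_apply')
      have "walk A S B (?c j) (drop j \<tau>)" "P (?c j + sum_list (drop j \<tau>))"
        using \<tau> walk_append[of A S B x "take j \<tau>" "drop j \<tau>"]
        by (simp_all add: add.assoc flip: sum_list_append)
      moreover have "agree B (?c j + sum_list (drop j \<tau>)) (?c i + sum_list (drop j \<tau>))"
        using ag by simp
      ultimately have "walk A S B (?c i) (drop j \<tau>)" "P (?c i + sum_list (drop j \<tau>))"
        using walk_agree[OF ag] P by blast+
      then have "?Q (take i \<tau> @ drop j \<tau>)"
        using \<tau> walk_take[of A S B x \<tau> i] by (simp add: walk_append add.assoc)
      from min[OF this] ij show False by simp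
    qed
  qed
  moreover have "?g ` {..<length \<tau>} \<subseteq> B \<rightarrow>\<^sub>E {0..<int l}"
  proof clarify
    fix j assume j: "j < length \<tau>"
    have w: "walk A S B x (take j \<tau>)" using \<tau> walk_take by blast
    then obtain y where y: "y \<in> S" "agree B y (?c j)" using walk_end by blast
    have "\<not> P (?c j)" using min[of "take j \<tau>"] w j by auto
    then have "\<not> P y" using P y by blast
    with y box[of y] show "?g j \<in> B \<rightarrow>\<^sub>E {0..<int l}"
      by (auto simp: agree_def)
  qed
  moreover have "finite (B \<rightarrow>\<^sub>E {0..<int l})" by (intro finite_PiE) auto
  ultimately have "card {..<length \<tau>} \<le> card (B \<rightarrow>\<^sub>E {0..<int l})"
    by (intro card_inj_on_le)
  also have "\<dots> = l ^ card B" by (simp add: card_PiE)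
  finally show ?thesis using \<tau> by auto
qed

section \<open>Strongly connected sets of configurations\<close>

text \<open>Abstracts from the component of mutually reachable configurations, so that the same
  results are available for the negated actions.\<close>

locale strongly_connected =
  fixes A S :: "(int ^ 'd::finite) set" and C :: "'d set" and a :: nat
  assumes nonneg: "y \<in> S \<Longrightarrow> i \<in> C \<Longrightarrow> 0 \<le> y $ i"
    and action_le: "v \<in> A \<Longrightarrow> \<bar>v $ i\<bar> \<le> int a"
    and connected: "x \<in> S \<Longrightarrow> y \<in> S \<Longrightarrow> \<exists>\<sigma>. walk A S UNIV x \<sigma> \<and> x + sum_list \<sigma> = y"
begin

lemma reversed: "strongly_connected (uminus ` A) S C a"
proof
  fix x y assume "x \<in> S" "y \<in> S"
  then obtain \<sigma> where \<sigma>: "walk A S UNIV y \<sigma>" "y + sum_list \<sigma> = x"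
    using connected by blast
  show "\<exists>\<sigma>. walk (uminus ` A) S UNIV x \<sigma> \<and> x + sum_list \<sigma> = y"
    using walk_reverse_actions[OF \<sigma>(1)] \<sigma>(2)
    by (intro exI[of _ "rev (map uminus \<sigma>)"]) auto
qed (use nonneg action_le in auto)

text \<open>The start \<open>x'\<close> need not lie in \<open>S\<close>. The displacement is
  nevertheless \<open>y - x\<close> in all components, not only in those of
  \<open>B\<close>.\<close>

lemma walk_connect:
  assumes "x \<in> S" "y \<in> S" "agree B x x'"
  shows "\<exists>\<sigma>. walk A S B x' \<sigma> \<and> sum_list \<sigma> = y - x"
proof -
  obtain \<sigma> where \<sigma>: "walk A S UNIV x \<sigma>" "x + sum_list \<sigma> = y"
    using connected assms by blast
  from \<sigma>(1) have "walk A S B x \<sigma>" by (rule walk_mono) simp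
  then have "walk A S B x' \<sigma>" using walk_agree assms(3) by blast
  then show ?thesis using \<sigma>(2) by (intro exI[of _ \<sigma>]) (auto simp: algebra_simps)
qed

text \<open>Each edge of the walk comes from two configurations of \<open>S\<close>, possibly
  different ones for each edge, and strong connectivity leads back between these with the opposite
  displacement. The return walks are joined in reverse order.\<close>

lemma walk_back:
  assumes "walk A S B x \<sigma>"
  shows "\<exists>\<tau>. walk A S B (x + sum_list \<sigma>) \<tau> \<and> sum_list \<tau> = - sum_list \<sigma>"
  using assms
proof (induction \<sigma> arbitrary: x)
  case Nil
  then show ?case by (intro exI[of _ "[]"]) simp
next
  case (Cons v \<sigma>)
  then obtain y where y: "y \<in> S" "y + v \<in> S" "agree B y x" by auto
  from Cons obtain \<tau> where \<tau>: "walk A S B (x + v + sum_list \<sigma>) \<tau>" "sum_list \<tau> = - sum_list \<sigma>"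
    by fastforce
  obtain \<rho> where \<rho>: "walk A S B (x + v) \<rho>" "sum_list \<rho> = - v"
    using walk_connect[OF y(2,1), of B "x + v"] y(3) by auto
  have "walk A S B (x + sum_list (v # \<sigma>)) (\<tau> @ \<rho>)"
    using \<tau> \<rho> by (simp add: walk_append add.assoc)
  moreover have "sum_list (\<tau> @ \<rho>) = - sum_list (v # \<sigma>)" using \<tau> \<rho> by simp
  ultimately show ?case by blast
qed

end

section \<open>Realising displacements by short cycles\<close>

text \<open>The first summand is the length of a tour through all nodes, the second that of the
  cycles of length at most \<open>N\<close> inserted into it. The power is the number of cycles
  given by \<open>short_sum\<close> for entries at most \<open>a * N\<close>; its target is bounded
  by \<open>W\<close> plus the displacement of the tour.\<close>

definition cycle_bound :: "nat \<Rightarrow> nat \<Rightarrow> nat \<Rightarrow> nat \<Rightarrow> nat" where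
  "cycle_bound d a N W =
     N * (N + 1) + N * (2 * (d * (a * N) + (W + a * (N * (N + 1)))) + 1) ^ d"

locale projected = strongly_connected A S C a
  for A S :: "(int ^ 'd::finite) set" and C a +
  fixes J :: "'d set" and l :: nat
  assumes J_subset: "J \<subseteq> C" and bounded: "y \<in> S \<Longrightarrow> i \<in> J \<Longrightarrow> y $ i < int l"
begin

text \<open>Bounds the number of nodes of the projected graph: each component in \<open>J\<close>
  takes one of \<open>l\<close> values.\<close>

definition N :: nat where "N = l ^ card J"

definition cycle :: "int ^ 'd \<Rightarrow> (int ^ 'd) list \<Rightarrow> bool" where
  "cycle x \<sigma> \<longleftrightarrow> walk A S J x \<sigma> \<and> agree J (sum_list \<sigma>) 0"

text \<open>The base points are arbitrary; short cycles with different base points are combined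
  later by attaching them to a common tour.\<close>

definition V :: "(int ^ 'd) set" where
  "V = {sum_list \<sigma> |\<sigma>. (\<exists>x. cycle x \<sigma>) \<and> length \<sigma> \<le> N}"

lemma short_walk:
  assumes "x \<in> S" "y \<in> S" "agree J x x'"
  shows "\<exists>\<sigma>. walk A S J x' \<sigma> \<and> agree J (x' + sum_list \<sigma>) y \<and> length \<sigma> \<le> N"
proof -
  obtain \<sigma> where \<sigma>: "walk A S J x' \<sigma>" "sum_list \<sigma> = y - x"
    using walk_connect[OF assms] by blast
  have ag: "agree J (x' + sum_list \<sigma>) y"
    using assms(3) \<sigma>(2) by (auto simp: agree_def)
  have "\<exists>\<tau>. walk A S J x' \<tau> \<and> agree J (x' + sum_list \<tau>) y \<and> length \<tau> \<le> l ^ card J"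
  proof (rule shorten_walk[OF \<sigma>(1), where P = "\<lambda>z. agree J z y", OF ag])
    show "agree J z' y" if "agree J z z'" "agree J z y" for z z'
      using that by (simp add: agree_def)
  qed (use nonneg bounded J_subset in auto)
  then show ?thesis unfolding N_def .
qed

lemma cycle_append:
  assumes "cycle x \<sigma>" "cycle x \<tau>"
  shows "cycle x (\<sigma> @ \<tau>)"
proof -
  have "agree J (x + sum_list \<sigma>) x" using assms by (simp add: cycle_def agree_def)
  from walk_agree[OF this] have "walk A S J (x + sum_list \<sigma>) \<tau>"
    using assms(2) unfolding cycle_def by blast
  moreover have "agree J (sum_list (\<sigma> @ \<tau>)) 0"
    using assms by (auto simp: cycle_def agree_def)
  ultimately show ?thesis using assms unfolding cycle_def walk_append by blast
qed

lemma cycle_back: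
  assumes "cycle x \<sigma>"
  shows "\<exists>\<tau>. cycle x \<tau> \<and> sum_list \<tau> = - sum_list \<sigma>"
proof -
  obtain \<tau> where \<tau>: "walk A S J (x + sum_list \<sigma>) \<tau>" "sum_list \<tau> = - sum_list \<sigma>"
    using walk_back[of J x \<sigma>] assms unfolding cycle_def by blast
  have "agree J (x + sum_list \<sigma>) x" using assms by (simp add: cycle_def agree_def)
  from walk_agree[OF this] have "walk A S J x \<tau>" using \<tau>(1) by blast
  with \<tau>(2) assms have "cycle x \<tau>" by (simp add: cycle_def agree_def)
  with \<tau>(2) show ?thesis by (intro exI conjI)
qed

text \<open>Pigeonhole: the positions 0 to \<open>N\<close> are \<open>N + 1\<close> in number, but
  their projections take at most \<open>N\<close> values.\<close>

lemma many_nodes_repeat: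
  assumes "walk A S J x \<sigma>" "N < length \<sigma>"
  shows "\<exists>i j. i < j \<and> j \<le> N \<and> agree J (x + sum_list (take i \<sigma>)) (x + sum_list (take j \<sigma>))"
proof -
  let ?c = "\<lambda>j. x + sum_list (take j \<sigma>)"
  let ?g = "\<lambda>j. restrict (($) (?c j)) J"
  have sub: "?g ` {..N} \<subseteq> J \<rightarrow>\<^sub>E {0..<int l}"
  proof clarify
    fix j
    obtain y where "y \<in> S" "agree J y (?c j)"
      using walk_end[OF walk_take[OF assms(1)]] by blast
    then have "0 \<le> ?c j $ i \<and> ?c j $ i < int l" if "i \<in> J" for i
      using bounded[of y i] nonneg[of y i] J_subset that by (auto simp: agree_def)
    then show "?g j \<in> J \<rightarrow>\<^sub>E {0..<int l}" by auto
  qed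
  have "\<not> (\<forall>i\<in>{..N}. \<forall>j\<in>{..N}. i < j \<longrightarrow> ?g i \<noteq> ?g j)"
  proof
    assume "\<forall>i\<in>{..N}. \<forall>j\<in>{..N}. i < j \<longrightarrow> ?g i \<noteq> ?g j"
    then have "inj_on ?g {..N}" by (intro linorder_inj_onI') blast
    then have "card {..N} \<le> card (J \<rightarrow>\<^sub>E {0..<int l})"
      using sub by (intro card_inj_on_le finite_PiE) auto
    then show False by (simp add: card_PiE N_def)
  qed
  then obtain i j where "i < j" "j \<le> N" "?g i = ?g j" by blast
  then show ?thesis unfolding agree_def by (metis restrict_apply')
qed

text \<open>A cycle longer than \<open>N\<close> contains a cycle of length at most
  \<open>N\<close>; cutting it out leaves a shorter cycle with the same base point.\<close>

lemma cycle_decomposition: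
  assumes "cycle x \<sigma>"
  shows "\<exists>vs\<in>lists V. sum_list vs = sum_list \<sigma>"
  using assms
proof (induction "length \<sigma>" arbitrary: \<sigma> rule: less_induct)
  case less
  show ?case
  proof (cases "length \<sigma> \<le> N")
    case True
    with less.prems have "sum_list \<sigma> \<in> V" unfolding V_def by blast
    then show ?thesis by (intro bexI[of _ "[sum_list \<sigma>]"]) auto
  next
    case False
    have w: "walk A S J x \<sigma>" "agree J (sum_list \<sigma>) 0" using less.prems by (auto simp: cycle_def)
    then obtain i j where ij: "i < j" "j \<le> N"
      and ag: "agree J (x + sum_list (take i \<sigma>)) (x + sum_list (take j \<sigma>))"
      using many_nodes_repeat False by (metis not_le)
    define \<mu> where "\<mu> = drop i (take j \<sigma>)"
    have tj: "take j \<sigma> = take i \<sigma> @ \<mu>"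
      using ij by (metis \<mu>_def append_take_drop_id less_imp_le min.absorb1 take_take)
    have \<sigma>: "\<sigma> = take i \<sigma> @ \<mu> @ drop j \<sigma>"
      by (metis append_assoc append_take_drop_id tj)
    have w3: "walk A S J x (take i \<sigma>)" "walk A S J (x + sum_list (take i \<sigma>)) \<mu>"
      "walk A S J (x + sum_list (take j \<sigma>)) (drop j \<sigma>)"
      using w(1) \<sigma> tj by (metis walk_append append_assoc append_take_drop_id)+
    have \<mu>0: "agree J (sum_list \<mu>) 0" using ag by (simp add: tj agree_def)
    then have "sum_list \<mu> \<in> V"
      using w3(2) ij by (auto simp: V_def cycle_def \<mu>_def)
    have s: "sum_list \<sigma> = sum_list \<mu> + sum_list (take i \<sigma> @ drop j \<sigma>)"
      by (subst \<sigma>) (simp add: algebra_simps)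
    have "cycle x (take i \<sigma> @ drop j \<sigma>)"
      unfolding cycle_def walk_append
      using w3 walk_agree[OF ag] w(2) \<mu>0 s by (auto simp: agree_def)
    moreover have "length (take i \<sigma> @ drop j \<sigma>) < length \<sigma>" using ij False by simp
    ultimately obtain vs where "vs \<in> lists V" "sum_list vs = sum_list (take i \<sigma> @ drop j \<sigma>)"
      using less.hyps by blast
    with s \<open>sum_list \<mu> \<in> V\<close> show ?thesis
      by (intro bexI[of _ "sum_list \<mu> # vs"]) auto
  qed
qed

lemma V_le: "v \<in> V \<Longrightarrow> \<bar>v $ k\<bar> \<le> int (a * N)"
proof -
  assume "v \<in> V"
  then obtain x \<sigma> where "walk A S J x \<sigma>" "v = sum_list \<sigma>" "length \<sigma> \<le> N"
    by (auto simp: V_def cycle_def)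
  then have "\<bar>v $ k\<bar> \<le> int (a * length \<sigma>)"
    using walk_displacement_le[OF _ action_le] by blast
  also have "\<dots> \<le> int (a * N)"
    using \<open>length \<sigma> \<le> N\<close> by (simp only: of_nat_le_iff mult_le_mono2)
  finally show ?thesis .
qed

section \<open>Tours and the insertion of cycles\<close>

definition tour :: "int ^ 'd \<Rightarrow> (int ^ 'd) list \<Rightarrow> bool" where
  "tour x \<sigma> \<longleftrightarrow> cycle x \<sigma> \<and> (\<forall>y\<in>S. \<exists>j\<le>length \<sigma>. agree J (x + sum_list (take j \<sigma>)) y)"

text \<open>A tour passes the base point of every short cycle, and the cycle is spliced in there.
  Positions behind the splice are shifted by the length of the cycle but keep their projections, so
  all nodes are still visited.\<close>

lemma insert_cycles:
  assumes "tour x \<sigma>" "vs \<in> lists V"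
  shows "\<exists>\<tau>. tour x \<tau> \<and> sum_list \<tau> = sum_list \<sigma> + sum_list vs
           \<and> length \<tau> \<le> length \<sigma> + N * length vs"
  using assms(2)
proof (induction vs)
  case Nil
  then show ?case using assms(1) by auto
next
  case (Cons v vs)
  then obtain \<tau> where \<tau>: "tour x \<tau>" "sum_list \<tau> = sum_list \<sigma> + sum_list vs"
    "length \<tau> \<le> length \<sigma> + N * length vs" by auto
  obtain z \<mu> where \<mu>: "walk A S J z \<mu>" "agree J (sum_list \<mu>) 0" "v = sum_list \<mu>" "length \<mu> \<le> N"
    using Cons.hyps by (auto simp: V_def cycle_def)
  obtain y where y: "y \<in> S" "agree J y z" using walk_start[OF \<mu>(1)] by blast
  obtain j where j: "j \<le> length \<tau>" "agree J (x + sum_list (take j \<tau>)) y"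
    using \<tau>(1) y(1) unfolding tour_def by blast
  define \<rho> where "\<rho> = take j \<tau> @ \<mu> @ drop j \<tau>"
  have \<tau>w: "walk A S J x (take j \<tau>)" "walk A S J (x + sum_list (take j \<tau>)) (drop j \<tau>)"
    using \<tau>(1) walk_append[of A S J x "take j \<tau>" "drop j \<tau>"] by (auto simp: tour_def cycle_def)
  have \<tau>s: "sum_list (take j \<tau>) + sum_list (drop j \<tau>) = sum_list \<tau>"
    by (simp flip: sum_list_append)
  have ag: "agree J z (x + sum_list (take j \<tau>))"
    using agree_trans[OF j(2) y(2)] by (simp add: agree_sym)
  have ag': "agree J (x + sum_list (take j \<tau>) + sum_list \<mu>) (x + sum_list (take j \<tau>))"
    using \<mu>(2) by (simp add: agree_def)
  have s: "sum_list \<rho> = sum_list \<tau> + v"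
    using \<tau>s \<mu>(3) by (simp add: \<rho>_def algebra_simps)
  have "cycle x \<rho>"
    unfolding cycle_def
  proof
    show "agree J (sum_list \<rho>) 0"
      using \<tau>(1) \<mu> s by (auto simp: tour_def cycle_def agree_def)
    show "walk A S J x \<rho>"
      using \<tau>w \<mu>(1) walk_agree[OF ag] walk_agree[OF ag'] by (simp add: \<rho>_def walk_append)
  qed
  moreover have "\<exists>i\<le>length \<rho>. agree J (x + sum_list (take i \<rho>)) y'" if y': "y' \<in> S" for y'
  proof -
    obtain i where i: "i \<le> length \<tau>" "agree J (x + sum_list (take i \<tau>)) y'"
      using \<tau>(1) y' unfolding tour_def by blast
    show ?thesis
    proof (cases "i \<le> j")
      case True
      with i j show ?thesis by (intro exI[of _ i]) (auto simp: \<rho>_def min_def)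
    next
      case False
      define m where "m = i - j"
      have i': "i = j + m" using False by (simp add: m_def)
      have "take i \<tau> = take j \<tau> @ take m (drop j \<tau>)" by (simp add: i' take_add)
      moreover have "take (i + length \<mu>) \<rho> = take j \<tau> @ \<mu> @ take m (drop j \<tau>)"
        using j(1) by (simp add: \<rho>_def i')
      ultimately have "agree J (x + sum_list (take (i + length \<mu>) \<rho>)) y'"
        using i(2) \<mu>(2) by (simp add: agree_def)
      with i(1) show ?thesis by (intro exI[of _ "i + length \<mu>"]) (auto simp: \<rho>_def)
    qed
  qed
  ultimately have "tour x \<rho>" by (simp add: tour_def)
  moreover have "length \<rho> \<le> length \<sigma> + N * length (v # vs)"
    using \<tau>(3) \<mu>(4) j(1) by (simp add: \<rho>_def)
  ultimately show ?case using s \<tau>(2) by (intro exI[of _ \<rho>]) (simp add: algebra_simps)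
qed

lemma visit_all:
  assumes "x \<in> S" "set ys \<subseteq> S"
  shows "\<exists>\<sigma>. walk A S J x \<sigma> \<and> length \<sigma> \<le> N * length ys
           \<and> (\<forall>y\<in>set ys. \<exists>j\<le>length \<sigma>. agree J (x + sum_list (take j \<sigma>)) y)"
  using assms(2)
proof (induction ys rule: rev_induct)
  case Nil
  have "walk A S J x []" unfolding walk.simps using assms(1) agree_refl by blast
  then show ?case by (intro exI[of _ "[]"]) simp
next
  case (snoc y ys)
  then obtain \<sigma> where \<sigma>: "walk A S J x \<sigma>" "length \<sigma> \<le> N * length ys"
    "\<forall>y\<in>set ys. \<exists>j\<le>length \<sigma>. agree J (x + sum_list (take j \<sigma>)) y" by fastforce
  obtain z where "z \<in> S" "agree J z (x + sum_list \<sigma>)" using walk_end[OF \<sigma>(1)] by blast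
  then obtain \<tau> where \<tau>: "walk A S J (x + sum_list \<sigma>) \<tau>"
    "agree J (x + sum_list \<sigma> + sum_list \<tau>) y" "length \<tau> \<le> N"
    using short_walk[of z y] snoc.prems by auto
  have "\<exists>j\<le>length (\<sigma> @ \<tau>). agree J (x + sum_list (take j (\<sigma> @ \<tau>))) y'"
    if "y' \<in> set (ys @ [y])" for y'
  proof (cases "y' = y")
    case True
    with \<tau>(2) show ?thesis by (intro exI[of _ "length (\<sigma> @ \<tau>)"]) (simp add: add.assoc)
  next
    case False
    with that \<sigma>(3) obtain j where "j \<le> length \<sigma>" "agree J (x + sum_list (take j \<sigma>)) y'" by auto
    then show ?thesis by (intro exI[of _ j]) auto
  qed
  moreover have "walk A S J x (\<sigma> @ \<tau>)" using \<sigma>(1) \<tau>(1) by (simp add: walk_append)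
  moreover have "length (\<sigma> @ \<tau>) \<le> N * length (ys @ [y])" using \<sigma>(2) \<tau>(3) by simp
  ultimately show ?case by blast
qed

text \<open>One configuration is chosen for each node; \<open>S\<close> may be infinite, its image
  under restriction to \<open>J\<close> is not.\<close>

lemma representatives:
  "\<exists>ys. set ys \<subseteq> S \<and> length ys \<le> N \<and> (\<forall>y\<in>S. \<exists>z\<in>set ys. agree J z y)"
proof -
  let ?r = "\<lambda>y :: int ^ 'd. restrict (($) y) J"
  have "0 \<le> y $ i \<and> y $ i < int l" if "y \<in> S" "i \<in> J" for y i
    using bounded[OF that] nonneg[OF that(1)] J_subset that(2) by auto
  then have sub: "?r ` S \<subseteq> J \<rightarrow>\<^sub>E {0..<int l}" by auto
  have fin: "finite (J \<rightarrow>\<^sub>E {0..<int l})" by (intro finite_PiE) auto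
  obtain Y where Y: "Y \<subseteq> S" "inj_on ?r Y" "?r ` S = ?r ` Y"
    using subset_image_inj[of "?r ` S" ?r S] by auto
  have "finite Y" using finite_subset[OF sub fin] Y(2,3) by (simp add: finite_image_iff)
  then obtain ys where ys: "set ys = Y" "distinct ys"
    using finite_distinct_list by blast
  have "length ys = card (?r ` S)"
    using ys Y by (simp add: card_image flip: distinct_card)
  also have "\<dots> \<le> N"
    using card_mono[OF fin sub] by (simp add: card_PiE N_def)
  finally have "length ys \<le> N" .
  moreover have "\<exists>z\<in>Y. agree J z y" if "y \<in> S" for y
  proof -
    have "?r y \<in> ?r ` Y" using that Y(3) by blast
    then obtain z where z: "z \<in> Y" "?r y = ?r z" by blast
    then have "agree J z y" unfolding agree_def by (metis restrict_apply')
    with z show ?thesis by blast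
  qed
  ultimately show ?thesis using ys Y(1) by (intro exI[of _ ys]) simp
qed

lemma tour_exists:
  assumes "x \<in> S"
  shows "\<exists>\<sigma>. tour x \<sigma> \<and> length \<sigma> \<le> N * (N + 1)"
proof -
  obtain ys where ys: "set ys \<subseteq> S" "length ys \<le> N" "\<forall>y\<in>S. \<exists>z\<in>set ys. agree J z y"
    using representatives by blast
  obtain \<sigma> where \<sigma>: "walk A S J x \<sigma>" "length \<sigma> \<le> N * length ys"
    "\<forall>y\<in>set ys. \<exists>j\<le>length \<sigma>. agree J (x + sum_list (take j \<sigma>)) y"
    using visit_all[OF assms ys(1)] by blast
  obtain z where "z \<in> S" "agree J z (x + sum_list \<sigma>)" using walk_end[OF \<sigma>(1)] by blast
  then obtain \<tau> where \<tau>: "walk A S J (x + sum_list \<sigma>) \<tau>"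
    "agree J (x + sum_list \<sigma> + sum_list \<tau>) x" "length \<tau> \<le> N"
    using short_walk[OF _ assms] by blast
  have "agree J (sum_list (\<sigma> @ \<tau>)) 0"
    using \<tau>(2) by (auto simp: agree_def)
  moreover have "walk A S J x (\<sigma> @ \<tau>)"
    using \<sigma>(1) \<tau>(1) by (simp only: walk_append)
  ultimately have "cycle x (\<sigma> @ \<tau>)" unfolding cycle_def by blast
  moreover have "\<exists>j\<le>length (\<sigma> @ \<tau>). agree J (x + sum_list (take j (\<sigma> @ \<tau>))) y" if "y \<in> S" for y
  proof -
    from bspec[OF ys(3) that] obtain z where z: "z \<in> set ys" "agree J z y" by blast
    from bspec[OF \<sigma>(3) z(1)] obtain j
      where j: "j \<le> length \<sigma>" "agree J (x + sum_list (take j \<sigma>)) z" by blast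
    have "agree J (x + sum_list (take j (\<sigma> @ \<tau>))) y"
      using agree_trans[OF j(2) z(2)] j(1) by simp
    moreover have "j \<le> length (\<sigma> @ \<tau>)" using j(1) by simp
    ultimately show ?thesis by blast
  qed
  moreover have "length (\<sigma> @ \<tau>) \<le> N * (N + 1)"
    using order.trans[OF \<sigma>(2) mult_le_mono2[OF ys(2)]] \<tau>(3) by simp
  ultimately show ?thesis unfolding tour_def by blast
qed

text \<open>The tour \<open>\<rho>\<close> is fixed first. What is missing from the wanted
  displacement belongs to a cycle, since \<open>\<rho>\<close> can be undone; it is therefore a sum
  over \<open>V\<close>, by \<open>short_sum\<close> one with few summands, and the corresponding
  cycles are spliced into \<open>\<rho>\<close>.\<close>

lemma short_cycle:
  assumes "x \<in> S" "cycle x \<sigma>" "\<And>k. \<bar>sum_list \<sigma> $ k\<bar> \<le> int W"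
  shows "\<exists>\<tau>. cycle x \<tau> \<and> sum_list \<tau> = sum_list \<sigma> \<and> length \<tau> \<le> cycle_bound CARD('d) a N W"
proof -
  let ?K = "(2 * (CARD('d) * (a * N) + (W + a * (N * (N + 1)))) + 1) ^ CARD('d)"
  obtain \<rho> where \<rho>: "tour x \<rho>" "length \<rho> \<le> N * (N + 1)" using tour_exists[OF assms(1)] by blast
  then have "cycle x \<rho>" by (simp add: tour_def)
  then obtain \<rho>' where \<rho>': "cycle x \<rho>'" "sum_list \<rho>' = - sum_list \<rho>" using cycle_back by blast
  obtain vs where vs: "vs \<in> lists V" "sum_list vs = sum_list \<sigma> - sum_list \<rho>"
    using cycle_decomposition[OF cycle_append[OF assms(2) \<rho>'(1)]] \<rho>'(2) by auto
  have "\<bar>sum_list vs $ k\<bar> \<le> int (W + a * (N * (N + 1)))" for k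
  proof -
    have "\<bar>sum_list \<rho> $ k\<bar> \<le> int (a * length \<rho>)"
      using \<open>cycle x \<rho>\<close> action_le unfolding cycle_def by (blast intro: walk_displacement_le)
    also have "\<dots> \<le> int (a * (N * (N + 1)))"
      using \<rho>(2) by (simp only: of_nat_le_iff mult_le_mono2)
    finally show ?thesis using assms(3)[of k] by (simp add: vs(2))
  qed
  from short_sum[OF V_le vs(1) this] obtain ws where ws: "ws \<in> lists V"
    "sum_list ws = sum_list vs" "length ws \<le> ?K"
    by blast
  obtain \<tau> where \<tau>: "tour x \<tau>" "sum_list \<tau> = sum_list \<rho> + sum_list ws"
    "length \<tau> \<le> length \<rho> + N * length ws"
    using insert_cycles[OF \<rho>(1) ws(1)] by blast
  have "N * length ws \<le> N * ?K" using ws(3) by (rule mult_le_mono2)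
  with \<rho>(2) \<tau>(3) have "length \<tau> \<le> cycle_bound CARD('d) a N W"
    unfolding cycle_bound_def by linarith
  with \<tau> ws(2) vs(2) show ?thesis by (intro exI[of _ \<tau>]) (simp add: tour_def)
qed

end

section \<open>Pumping\<close>

text \<open>Components outside \<open>C\<close> may become negative; they stand for the starred
  components.\<close>

definition fires :: "'d set \<Rightarrow> int ^ 'd \<Rightarrow> (int ^ 'd) list \<Rightarrow> bool" where
  "fires C x \<sigma> \<longleftrightarrow> (\<forall>j\<le>length \<sigma>. \<forall>i\<in>C. 0 \<le> (x + sum_list (take j \<sigma>)) $ i)"

lemma fires_append:
  "fires C x (\<sigma> @ \<tau>) \<longleftrightarrow> fires C x \<sigma> \<and> fires C (x + sum_list \<sigma>) \<tau>"
proof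
  assume *: "fires C x (\<sigma> @ \<tau>)"
  have "0 \<le> (x + sum_list (take j \<sigma>)) $ i" if "j \<le> length \<sigma>" "i \<in> C" for i j
    using * that unfolding fires_def by (auto dest: spec[of _ j])
  moreover have "0 \<le> (x + sum_list \<sigma> + sum_list (take j \<tau>)) $ i"
    if "j \<le> length \<tau>" "i \<in> C" for i j
    using * that unfolding fires_def by (auto dest!: spec[of _ "length \<sigma> + j"] simp: add.assoc)
  ultimately show "fires C x \<sigma> \<and> fires C (x + sum_list \<sigma>) \<tau>" by (simp add: fires_def)
next
  assume *: "fires C x \<sigma> \<and> fires C (x + sum_list \<sigma>) \<tau>"
  have "0 \<le> (x + sum_list (take j (\<sigma> @ \<tau>))) $ i"
    if "j \<le> length (\<sigma> @ \<tau>)" "i \<in> C" for i j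
  proof (cases "j \<le> length \<sigma>")
    case True
    with * that show ?thesis by (simp add: fires_def)
  next
    case False
    then have "0 \<le> (x + sum_list \<sigma> + sum_list (take (j - length \<sigma>) \<tau>)) $ i"
      using * that unfolding fires_def by (metis add_diff_inverse_nat le_diff_conv length_append add.commute not_le)
    with False show ?thesis by (simp add: add.assoc)
  qed
  then show "fires C x (\<sigma> @ \<tau>)" by (simp add: fires_def)
qed

lemma fires_mono:
  assumes "fires C x \<sigma>" "\<And>i. i \<in> C \<Longrightarrow> x $ i \<le> y $ i"
  shows "fires C y \<sigma>"
  unfolding fires_def
proof (intro allI impI ballI)
  fix j i assume "j \<le> length \<sigma>" "i \<in> C"
  then have "0 \<le> (x + sum_list (take j \<sigma>)) $ i" using assms(1) by (simp add: fires_def)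
  with assms(2)[OF \<open>i \<in> C\<close>] show "0 \<le> (y + sum_list (take j \<sigma>)) $ i" by simp
qed

lemma fires_Cons: "fires C x (v # \<sigma>) \<longleftrightarrow> (\<forall>i\<in>C. 0 \<le> x $ i) \<and> fires C (x + v) \<sigma>"
proof -
  have "fires C x [v] \<longleftrightarrow> (\<forall>i\<in>C. 0 \<le> x $ i) \<and> (\<forall>i\<in>C. 0 \<le> (x + v) $ i)"
    by (auto simp: fires_def le_Suc_eq)
  moreover have "\<forall>i\<in>C. 0 \<le> (x + v) $ i" if "fires C (x + v) \<sigma>"
    using that unfolding fires_def by (auto dest: spec[of _ 0])
  ultimately show ?thesis using fires_append[of C x "[v]" \<sigma>] by auto
qed

lemma fires_Nil: "fires C x [] \<longleftrightarrow> (\<forall>i\<in>C. 0 \<le> x $ i)"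
  by (simp add: fires_def)

lemma fires_reverse_actions:
  "fires C x \<sigma> \<Longrightarrow> fires C (x + sum_list \<sigma>) (rev (map uminus \<sigma>))"
proof (induction \<sigma> arbitrary: x)
  case (Cons v \<sigma>)
  have "sum_list (rev (map uminus \<sigma>)) = - sum_list \<sigma>" by (induction \<sigma>) auto
  moreover have "\<forall>i\<in>C. 0 \<le> x $ i" "fires C (x + v) \<sigma>"
    using Cons.prems by (simp_all add: fires_Cons)
  moreover from this(2) have "\<forall>i\<in>C. 0 \<le> (x + v) $ i" by (cases \<sigma>) (simp_all add: fires_Cons fires_Nil)
  ultimately show ?case
    using Cons.IH[of "x + v"]
    by (simp add: fires_append fires_Cons fires_Nil add.assoc algebra_simps del: rev_map sum_list_rev)
qed simp

lemma sum_list_repeat: "sum_list (concat (replicate m \<sigma>)) = int m *s sum_list (\<sigma> :: (int ^ 'd) list)"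
  by (induction m) (simp_all add: vec_eq_iff algebra_simps)

lemma length_repeat: "length (concat (replicate m \<sigma>)) = m * length \<sigma>"
  by (induction m) simp_all

lemma fires_repeat:
  assumes "\<And>j. j < m \<Longrightarrow> fires C (x + int j *s sum_list \<sigma>) \<sigma>" "\<And>i. i \<in> C \<Longrightarrow> 0 \<le> x $ i"
  shows "fires C x (concat (replicate m \<sigma>))"
  using assms
proof (induction m)
  case (Suc m)
  have "replicate (Suc m) \<sigma> = replicate m \<sigma> @ [\<sigma>]" by (simp add: replicate_append_same)
  then show ?case using Suc by (simp add: fires_append sum_list_repeat)
qed (simp add: fires_Nil)

text \<open>Thresholds of the Rackoff-style argument: a component that has reached
  \<open>lam (Suc m)\<close> is still at least \<open>lam m\<close> after a simple path in the projection to
  \<open>m\<close> components that are below \<open>lam m\<close>.\<close>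

primrec lam :: "nat \<Rightarrow> nat \<Rightarrow> nat \<Rightarrow> nat" where
  "lam s a 0 = s + 1"
| "lam s a (Suc m) = lam s a m + a * lam s a m ^ m"

text \<open>The length of the word \<open>u\<^sup>m \<pi> \<theta>\<^sup>m v\<^sup>m\<close> when
  \<open>u\<close> and \<open>v\<close> have length at most \<open>U\<close>, \<open>\<pi>\<close>
  and \<open>\<theta>\<close> at most \<open>F\<close>, and m is \<open>a * F\<close>. The argument
  \<open>n\<close> stands for the cardinality of \<open>J\<close>.\<close>

definition run_bound :: "nat \<Rightarrow> nat \<Rightarrow> nat \<Rightarrow> nat \<Rightarrow> nat" where
  "run_bound d s a n =
     (let U = \<Sum>i\<le>d. lam s a i ^ i; N = lam s a n ^ n; F = N + cycle_bound d a N (s + 2 * a * U)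
      in a * F * (2 * U + F) + F)"

lemma lam_mono: "m \<le> n \<Longrightarrow> lam s a m \<le> lam s a n"
  by (rule lift_Suc_mono_le) auto

lemma lam_ge: "s + 1 \<le> lam s a m"
  using lam_mono[of 0 m s a] by simp

section \<open>Raising all unbounded components\<close>

context strongly_connected
begin

text \<open>On \<open>B\<close> the walk agrees with elements of \<open>S\<close>, which are
  nonnegative on \<open>C\<close>. Outside \<open>B\<close> a step costs at most \<open>a\<close>,
  so a reserve of \<open>a * length \<tau>\<close> suffices and \<open>c\<close> is left
  over.\<close>

lemma walk_fires:
  assumes "walk A S B x \<tau>" "\<And>i. i \<in> C - B \<Longrightarrow> int (c + a * length \<tau>) \<le> x $ i"
  shows "fires C x \<tau>" "\<And>i. i \<in> C - B \<Longrightarrow> int c \<le> (x + sum_list \<tau>) $ i"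
proof -
  have drop: "int c \<le> (x + sum_list (take j \<tau>)) $ i" if "i \<in> C - B" for i j
  proof -
    have "\<bar>sum_list (take j \<tau>) $ i\<bar> \<le> int (a * length (take j \<tau>))"
      using walk_displacement_le[OF walk_take[OF assms(1)] action_le] .
    also have "\<dots> \<le> int (a * length \<tau>)"
      by (simp only: of_nat_le_iff) simp
    finally show ?thesis using assms(2)[OF that] by simp
  qed
  show "fires C x \<tau>"
    unfolding fires_def
  proof (intro allI impI ballI)
    fix j i assume "i \<in> C"
    show "0 \<le> (x + sum_list (take j \<tau>)) $ i"
    proof (cases "i \<in> B")
      case True
      obtain y where "y \<in> S" "agree B y (x + sum_list (take j \<tau>))"
        using walk_end[OF walk_take[OF assms(1)]] by blast
      then show ?thesis using nonneg[of y i] \<open>i \<in> C\<close> True by (simp add: agree_def)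
    next
      case False
      with drop[of i j] \<open>i \<in> C\<close> show ?thesis by simp
    qed
  qed
  show "int c \<le> (x + sum_list \<tau>) $ i" if "i \<in> C - B" for i
    using drop[OF that, of "length \<tau>"] by simp
qed

text \<open>Rackoff's induction, downwards from \<open>m = card C\<close>. While \<open>B\<close> is
  larger than \<open>J\<close>, some component in \<open>B\<close> reaches its threshold somewhere
  in \<open>S\<close>; a shortest walk to such a place is short, and the component that has become
  large leaves \<open>B\<close>.\<close>

lemma pump_stages:
  assumes "p \<in> S" "J \<subseteq> C"
    and bd: "\<And>y i. y \<in> S \<Longrightarrow> i \<in> J \<Longrightarrow> y $ i < int (lam s a (card J))"
    and big: "\<And>B. J \<subset> B \<Longrightarrow> B \<subseteq> C \<Longrightarrow> \<exists>y\<in>S. \<exists>i\<in>B. int (lam s a (card B)) \<le> y $ i"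
    and m: "card J \<le> m" "m \<le> card C"
  shows "\<exists>B u. J \<subseteq> B \<and> B \<subseteq> C \<and> card B = m \<and> walk A S B p u \<and> fires C p u
           \<and> (\<forall>i\<in>C - B. int (lam s a (Suc m)) \<le> (p + sum_list u) $ i)
           \<and> length u \<le> (\<Sum>i\<in>{Suc m..card C}. lam s a i ^ i)"
  using m(2,1)
proof (induction m rule: inc_induct)
  case base
  have "walk A S C p []" unfolding walk.simps using assms(1) agree_refl by blast
  with assms(1,2) nonneg show ?case
    by (intro exI[of _ C] exI[of _ "[]"]) (simp add: fires_Nil)
next
  case (step m)
  let ?L = "lam s a (Suc m)"
  obtain B u where B: "J \<subseteq> B" "B \<subseteq> C" "card B = Suc m"
    and u: "walk A S B p u" "fires C p u"
    and high: "\<And>i. i \<in> C - B \<Longrightarrow> int (lam s a (Suc (Suc m))) \<le> (p + sum_list u) $ i"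
    and len: "length u \<le> (\<Sum>i\<in>{Suc (Suc m)..card C}. lam s a i ^ i)"
    using step by auto
  have "J \<noteq> B" using step.prems B(3) by auto
  with B have "J \<subset> B" by blast
  from big[OF this B(2)] obtain y k where y: "y \<in> S" "k \<in> B" "int ?L \<le> y $ k"
    unfolding B(3) by blast
  obtain z where z: "z \<in> S" "agree B z (p + sum_list u)" using walk_end[OF u(1)] by blast
  obtain \<sigma> where \<sigma>: "walk A S B (p + sum_list u) \<sigma>" "sum_list \<sigma> = y - z"
    using walk_connect[OF z(1) y(1) z(2)] by blast
  let ?P = "\<lambda>w. \<exists>i\<in>B. int ?L \<le> w $ i"
  have "?P (p + sum_list u + sum_list \<sigma>)"
    using y z(2) \<sigma>(2) by (intro bexI[of _ k]) (auto simp: agree_def)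
  moreover have "?P w'" if "agree B w w'" "?P w" for w w'
    using that by (auto simp: agree_def)
  moreover have "0 \<le> w $ i \<and> w $ i < int ?L" if "w \<in> S" "i \<in> B" "\<not> ?P w" for w i
    using that nonneg[of w i] B(2) by force
  ultimately obtain \<tau> where \<tau>: "walk A S B (p + sum_list u) \<tau>"
    "?P (p + sum_list u + sum_list \<tau>)" "length \<tau> \<le> ?L ^ card B"
    using shorten_walk[OF \<sigma>(1), of ?P ?L] by blast
  \<comment> \<open>The gap between consecutive thresholds is exactly what a walk of length
    \<open>?L ^ Suc m\<close> can consume.\<close>
  have slack: "int (?L + a * length \<tau>) \<le> (p + sum_list u) $ i" if "i \<in> C - B" for i
  proof -
    have "a * length \<tau> \<le> a * ?L ^ Suc m" using \<tau>(3) unfolding B(3) by (rule mult_le_mono2)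
    then have "?L + a * length \<tau> \<le> lam s a (Suc (Suc m))" by simp
    then show ?thesis using high[OF that] by linarith
  qed
  have fire1: "fires C (p + sum_list u) \<tau>"
    by (rule walk_fires(1)[OF \<tau>(1)]) (rule slack)
  have fire2: "int ?L \<le> (p + sum_list u + sum_list \<tau>) $ i" if "i \<in> C - B" for i
    by (rule walk_fires(2)[OF \<tau>(1) _ that]) (rule slack)
  obtain i0 where i0: "i0 \<in> B" "int ?L \<le> (p + sum_list u + sum_list \<tau>) $ i0"
    using \<tau>(2) by blast
  obtain w where w: "w \<in> S" "agree B w (p + sum_list u + sum_list \<tau>)"
    using walk_end[OF \<tau>(1)] by blast
  \<comment> \<open>Components in \<open>J\<close> stay below \<open>lam s a (card J)\<close>, which
    is at most \<open>?L\<close>, so removing \<open>i0\<close> from \<open>B\<close> keeps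
    \<open>J\<close> inside.\<close>
  have "i0 \<notin> J"
  proof
    assume "i0 \<in> J"
    then have "w $ i0 < int (lam s a (card J))" using bd w(1) by blast
    also have "\<dots> \<le> int ?L"
      unfolding of_nat_le_iff using step.prems by (intro lam_mono) simp
    finally show False using i0 w(2) by (auto simp: agree_def)
  qed
  let ?B = "B - {i0}"
  have "walk A S ?B p (u @ \<tau>)"
    by (rule walk_mono[of _ _ B]) (auto simp: walk_append u(1) \<tau>(1))
  moreover have "fires C p (u @ \<tau>)" using u(2) fire1 by (simp add: fires_append)
  moreover have "int ?L \<le> (p + sum_list (u @ \<tau>)) $ i" if "i \<in> C - ?B" for i
  proof (cases "i = i0")
    case True
    with i0(2) show ?thesis by (simp add: add.assoc)
  next
    case False
    with that have "i \<in> C - B" by blast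
    from fire2[OF this] show ?thesis by (simp add: add.assoc)
  qed
  moreover have "length (u @ \<tau>) \<le> (\<Sum>i\<in>{Suc m..card C}. lam s a i ^ i)"
  proof -
    have "{Suc m..card C} = insert (Suc m) {Suc (Suc m)..card C}"
      using step.hyps by auto
    with len \<tau>(3) show ?thesis unfolding B(3) by simp
  qed
  moreover have "card ?B = m" using B(3) i0(1) by simp
  moreover have "J \<subseteq> ?B" "?B \<subseteq> C" using B \<open>i0 \<notin> J\<close> by auto
  ultimately show ?case by blast
qed

text \<open>After the last stage a path of length at most \<open>N\<close> closes the walk in the
  projection to \<open>J\<close>. The last gap between thresholds pays for it, and at least
  \<open>lam s a (card J)\<close>, hence \<open>s + 1\<close>, remains outside
  \<open>J\<close>.\<close>

lemma pump:
  assumes "p \<in> S" "J \<subseteq> C"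
    and bd: "\<And>y i. y \<in> S \<Longrightarrow> i \<in> J \<Longrightarrow> y $ i < int (lam s a (card J))"
    and big: "\<And>B. J \<subset> B \<Longrightarrow> B \<subseteq> C \<Longrightarrow> \<exists>y\<in>S. \<exists>i\<in>B. int (lam s a (card B)) \<le> y $ i"
  shows "\<exists>u. walk A S J p u \<and> agree J (sum_list u) 0 \<and> fires C p u
           \<and> (\<forall>i\<in>C - J. int (s + 1) \<le> (p + sum_list u) $ i)
           \<and> length u \<le> (\<Sum>i\<le>CARD('d). lam s a i ^ i)"
proof -
  interpret projected A S C a J "lam s a (card J)"
    using assms by unfold_locales auto
  have JC: "card J \<le> card C" using assms(2) by (simp add: card_mono)
  obtain B u where B: "J \<subseteq> B" "B \<subseteq> C" "card B = card J"
    and u: "walk A S B p u" "fires C p u"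
    and high: "\<And>i. i \<in> C - B \<Longrightarrow> int (lam s a (Suc (card J))) \<le> (p + sum_list u) $ i"
    and len: "length u \<le> (\<Sum>i\<in>{Suc (card J)..card C}. lam s a i ^ i)"
    using pump_stages[OF assms order.refl JC] by blast
  have [simp]: "B = J" using B(1,3) by (metis card_subset_eq finite)
  obtain z where z: "z \<in> S" "agree J z (p + sum_list u)" using walk_end[OF u(1)] by auto
  obtain \<tau> where \<tau>: "walk A S J (p + sum_list u) \<tau>"
    "agree J (p + sum_list u + sum_list \<tau>) p" "length \<tau> \<le> N"
    using short_walk[OF z(1) assms(1) z(2)] by blast
  have slack: "int (lam s a (card J) + a * length \<tau>) \<le> (p + sum_list u) $ i" if "i \<in> C - J" for i
  proof -
    have "a * length \<tau> \<le> a * lam s a (card J) ^ card J"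
      using \<tau>(3) unfolding N_def by (rule mult_le_mono2)
    then have "lam s a (card J) + a * length \<tau> \<le> lam s a (Suc (card J))" by simp
    moreover have "int (lam s a (Suc (card J))) \<le> (p + sum_list u) $ i" using high that by simp
    ultimately show ?thesis by linarith
  qed
  have fire1: "fires C (p + sum_list u) \<tau>"
    by (rule walk_fires(1)[OF \<tau>(1)]) (rule slack)
  have fire2: "int (lam s a (card J)) \<le> (p + sum_list u + sum_list \<tau>) $ i" if "i \<in> C - J" for i
    by (rule walk_fires(2)[OF \<tau>(1) _ that]) (rule slack)
  have "walk A S J p (u @ \<tau>)" using u(1) \<tau>(1) by (simp add: walk_append)
  moreover have "agree J (sum_list (u @ \<tau>)) 0" using \<tau>(2) by (auto simp: agree_def)
  moreover have "fires C p (u @ \<tau>)" using u(2) fire1 by (simp add: fires_append)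
  moreover have "int (s + 1) \<le> (p + sum_list (u @ \<tau>)) $ i" if "i \<in> C - J" for i
  proof -
    have "int (s + 1) \<le> int (lam s a (card J))" using lam_ge by (simp only: of_nat_le_iff)
    also have "\<dots> \<le> (p + sum_list u + sum_list \<tau>) $ i" using fire2[OF that] .
    finally show ?thesis by (simp add: add.assoc)
  qed
  moreover have "length (u @ \<tau>) \<le> (\<Sum>i\<le>CARD('d). lam s a i ^ i)"
  proof -
    have "card C \<le> CARD('d)" by (simp add: card_mono)
    have "length (u @ \<tau>) \<le> (\<Sum>i\<in>insert (card J) {Suc (card J)..card C}. lam s a i ^ i)"
      using len \<tau>(3) by (simp add: N_def)
    also have "\<dots> \<le> (\<Sum>i\<le>CARD('d). lam s a i ^ i)"
      using \<open>card C \<le> CARD('d)\<close> JC by (intro sum_mono2) auto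
    finally show ?thesis .
  qed
  ultimately show ?thesis by blast
qed

lemma pump_back:
  assumes "q \<in> S" "J \<subseteq> C"
    and bd: "\<And>y i. y \<in> S \<Longrightarrow> i \<in> J \<Longrightarrow> y $ i < int (lam s a (card J))"
    and big: "\<And>B. J \<subset> B \<Longrightarrow> B \<subseteq> C \<Longrightarrow> \<exists>y\<in>S. \<exists>i\<in>B. int (lam s a (card B)) \<le> y $ i"
  shows "\<exists>v. walk A S J q v \<and> agree J (sum_list v) 0 \<and> fires C (q - sum_list v) v
           \<and> (\<forall>i\<in>C - J. int (s + 1) \<le> (q - sum_list v) $ i)
           \<and> length v \<le> (\<Sum>i\<le>CARD('d). lam s a i ^ i)"
proof -
  obtain u where u: "walk (uminus ` A) S J q u" "agree J (sum_list u) 0" "fires C q u"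
    "\<forall>i\<in>C - J. int (s + 1) \<le> (q + sum_list u) $ i"
    "length u \<le> (\<Sum>i\<le>CARD('d). lam s a i ^ i)"
    using strongly_connected.pump[OF reversed assms] by blast
  let ?v = "rev (map uminus u)"
  have sum: "sum_list ?v = - sum_list u"
    by (rule walk_reverse_actions(2)[OF u(1)])
  have "walk A S J (q + sum_list u) ?v"
    using walk_reverse_actions(1)[OF u(1)] by (simp add: image_image)
  moreover have "agree J (q + sum_list u) q" using u(2) by (simp add: agree_def)
  ultimately have "walk A S J q ?v" using walk_agree[of J "q + sum_list u" q] by blast
  moreover have "fires C (q - sum_list ?v) ?v"
    using fires_reverse_actions[OF u(3)] unfolding sum by simp
  moreover have "agree J (sum_list ?v) 0" using u(2) unfolding sum by (simp add: agree_def)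
  moreover have "\<forall>i\<in>C - J. int (s + 1) \<le> (q - sum_list ?v) $ i" using u(4) unfolding sum by simp
  moreover have "length ?v \<le> (\<Sum>i\<le>CARD('d). lam s a i ^ i)" using u(5) by simp
  ultimately show ?thesis by blast
qed

text \<open>The empty set qualifies, so a maximal \<open>J\<close> exists. As the threshold depends
  on the cardinality, the defining property need not pass to subsets; maximality is therefore used
  against all larger \<open>B\<close>, not only against one-element extensions.\<close>

lemma maximal_small_set:
  obtains J where "J \<subseteq> C" "\<And>y i. y \<in> S \<Longrightarrow> i \<in> J \<Longrightarrow> y $ i < int (lam s a (card J))"
    "\<And>B. J \<subset> B \<Longrightarrow> B \<subseteq> C \<Longrightarrow> \<exists>y\<in>S. \<exists>i\<in>B. int (lam s a (card B)) \<le> y $ i"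
proof -
  define X where "X = {J. J \<subseteq> C \<and> (\<forall>y\<in>S. \<forall>i\<in>J. y $ i < int (lam s a (card J)))}"
  have "finite X" by simp
  moreover have "{} \<in> X" by (simp add: X_def)
  ultimately obtain J where J: "J \<in> X" "\<And>B. B \<in> X \<Longrightarrow> J \<subseteq> B \<Longrightarrow> B = J"
    using finite_has_maximal[of X] by blast
  have "\<exists>y\<in>S. \<exists>i\<in>B. int (lam s a (card B)) \<le> y $ i" if "J \<subset> B" "B \<subseteq> C" for B
  proof (rule ccontr)
    assume "\<not> ?thesis"
    then have "B \<in> X" using that(2) unfolding X_def by (simp add: not_le)
    from J(2)[OF this] that(1) show False by blast
  qed
  with J(1) show ?thesis by (intro that[of J]) (auto simp: X_def)
qed

section \<open>The pumped word from p to q\<close>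

text \<open>As \<open>p\<close> and \<open>q\<close> are at most \<open>s\<close> on
  \<open>C\<close> and the pumping words reach \<open>s + 1\<close>, \<open>u\<close> strictly
  raises and \<open>v\<close> strictly lowers every component of \<open>C - J\<close>. The witness
  for \<open>n\<close> is \<open>card J\<close>.\<close>

lemma short_run:
  assumes "p \<in> S" "q \<in> S"
    and s: "\<And>i. i \<in> C \<Longrightarrow> p $ i \<le> int s" "\<And>i. i \<in> C \<Longrightarrow> q $ i \<le> int s"
      "\<And>k. \<bar>(q - p) $ k\<bar> \<le> int s"
  shows "\<exists>\<sigma>\<in>lists A. fires C p \<sigma> \<and> sum_list \<sigma> = q - p \<and>
    (\<exists>n\<le>CARD('d). length \<sigma> \<le> run_bound CARD('d) s a n)"
proof (rule maximal_small_set[of s])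
  fix J
  assume J: "J \<subseteq> C" "\<And>y i. y \<in> S \<Longrightarrow> i \<in> J \<Longrightarrow> y $ i < int (lam s a (card J))"
    "\<And>B. J \<subset> B \<Longrightarrow> B \<subseteq> C \<Longrightarrow> \<exists>y\<in>S. \<exists>i\<in>B. int (lam s a (card B)) \<le> y $ i"
  interpret projected A S C a J "lam s a (card J)"
    using J by unfold_locales auto
  define U where "U = (\<Sum>i\<le>CARD('d). lam s a i ^ i)"
  \<comment> \<open>\<open>W\<close> bounds both displacements to be realised by cycles:
    \<open>q - p\<close> minus that of a path of length at most \<open>N\<close>, and minus those of
    \<open>u\<close> and \<open>v\<close>.\<close>
  define W where "W = s + 2 * a * U"
  define F where "F = N + cycle_bound CARD('d) a N W"
  \<comment> \<open>One pass of \<open>\<pi>\<close> or \<open>\<theta>\<close> lowers a component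
    by at most \<open>a * F\<close>, and \<open>m\<close> passes of \<open>u\<close> raise each
    component of \<open>C - J\<close> by at least \<open>m\<close>.\<close>
  define m where "m = a * F"
  have card_J: "card J \<le> CARD('d)" by (simp add: card_mono)
  have "N \<le> U" unfolding N_def U_def
    using card_J by (intro member_le_sum) auto
  then have aN: "a * N \<le> a * U" by simp
  obtain u where u: "walk A S J p u" "agree J (sum_list u) 0" "fires C p u"
    "\<And>i. i \<in> C - J \<Longrightarrow> int (s + 1) \<le> (p + sum_list u) $ i" "length u \<le> U"
    using pump[OF assms(1) J] unfolding U_def by blast
  obtain v where v: "walk A S J q v" "agree J (sum_list v) 0" "fires C (q - sum_list v) v"
    "\<And>i. i \<in> C - J \<Longrightarrow> int (s + 1) \<le> (q - sum_list v) $ i" "length v \<le> U"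
    using pump_back[OF assms(2) J] unfolding U_def by blast
  have u_gain: "1 \<le> sum_list u $ i" if "i \<in> C - J" for i
    using u(4)[OF that] s(1)[of i] that by simp
  have v_gain: "sum_list v $ i \<le> - 1" if "i \<in> C - J" for i
    using v(4)[OF that] s(2)[of i] that by simp
  have uJ: "sum_list u $ i = 0" and vJ: "sum_list v $ i = 0" if "i \<in> J" for i
    using u(2) v(2) that by (auto simp: agree_def)
  have u_abs: "\<bar>sum_list u $ k\<bar> \<le> int (a * U)" for k
  proof -
    have "\<bar>sum_list u $ k\<bar> \<le> int (a * length u)" by (rule walk_displacement_le[OF u(1) action_le])
    also have "\<dots> \<le> int (a * U)" using u(5) by (simp only: of_nat_le_iff mult_le_mono2)
    finally show ?thesis .
  qed
  have v_abs: "\<bar>sum_list v $ k\<bar> \<le> int (a * U)" for k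
  proof -
    have "\<bar>sum_list v $ k\<bar> \<le> int (a * length v)" by (rule walk_displacement_le[OF v(1) action_le])
    also have "\<dots> \<le> int (a * U)" using v(5) by (simp only: of_nat_le_iff mult_le_mono2)
    finally show ?thesis .
  qed
  obtain \<pi> where \<pi>: "walk A S J p \<pi>" "sum_list \<pi> = q - p" "length \<pi> \<le> F"
  proof -
    \<comment> \<open>A short path \<open>\<sigma>\<close> reaches the node of \<open>q\<close>,
      possibly with a wrong displacement. The error belongs to a cycle at \<open>q\<close>: undo
      \<open>\<sigma>\<close>, then follow a walk with displacement \<open>q - p\<close>. A short
      cycle with this displacement is appended to \<open>\<sigma>\<close>.\<close>
    obtain \<sigma> where \<sigma>: "walk A S J p \<sigma>" "agree J (p + sum_list \<sigma>) q" "length \<sigma> \<le> N"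
      using short_walk[OF assms(1,2) agree_refl] by blast
    obtain \<sigma>' where \<sigma>': "walk A S J (p + sum_list \<sigma>) \<sigma>'" "sum_list \<sigma>' = - sum_list \<sigma>"
      using walk_back[OF \<sigma>(1)] by blast
    have "agree J p (q - sum_list \<sigma>)" using \<sigma>(2) by (auto simp: agree_def algebra_simps)
    from walk_connect[OF assms(1,2) this] obtain \<rho>
      where \<rho>: "walk A S J (q - sum_list \<sigma>) \<rho>" "sum_list \<rho> = q - p" by blast
    have "walk A S J q \<sigma>'" using walk_agree[OF \<sigma>(2)] \<sigma>'(1) by blast
    then have "walk A S J q (\<sigma>' @ \<rho>)" using \<sigma>'(2) \<rho>(1) by (simp add: walk_append)
    moreover have sum: "sum_list (\<sigma>' @ \<rho>) = q - p - sum_list \<sigma>" using \<sigma>'(2) \<rho>(2) by simp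
    moreover have "agree J (q - p - sum_list \<sigma>) 0" using \<sigma>(2) by (auto simp: agree_def algebra_simps)
    ultimately have cyc: "cycle q (\<sigma>' @ \<rho>)" unfolding cycle_def by simp
    have "\<bar>sum_list (\<sigma>' @ \<rho>) $ k\<bar> \<le> int W" for k
    proof -
      have "\<bar>sum_list \<sigma> $ k\<bar> \<le> int (a * length \<sigma>)" by (rule walk_displacement_le[OF \<sigma>(1) action_le])
      also have "\<dots> \<le> int (a * N)" using \<sigma>(3) by (simp only: of_nat_le_iff mult_le_mono2)
      also have "\<dots> \<le> int (a * U)" using aN by (simp only: of_nat_le_iff)
      finally show ?thesis using s(3)[of k] unfolding sum W_def by simp
    qed
    from short_cycle[OF assms(2) cyc this] obtain \<tau>
      where \<tau>: "cycle q \<tau>" "sum_list \<tau> = sum_list (\<sigma>' @ \<rho>)" "length \<tau> \<le> cycle_bound CARD('d) a N W"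
      by blast
    have "walk A S J (p + sum_list \<sigma>) \<tau>"
      using walk_agree[OF \<sigma>(2)] \<tau>(1) unfolding cycle_def by blast
    with \<sigma>(1) have "walk A S J p (\<sigma> @ \<tau>)" by (simp only: walk_append)
    moreover have "sum_list (\<sigma> @ \<tau>) = q - p" using \<tau>(2) unfolding sum by simp
    moreover have "length (\<sigma> @ \<tau>) \<le> F" using \<sigma>(3) \<tau>(3) unfolding F_def by simp
    ultimately show ?thesis by (rule that)
  qed
  obtain \<theta> where \<theta>: "cycle q \<theta>" "sum_list \<theta> = - sum_list u - sum_list v" "length \<theta> \<le> F"
  proof -
    \<comment> \<open>The cycle goes from \<open>q\<close> to \<open>p\<close>, undoes
      \<open>u\<close>, returns to \<open>q\<close> and undoes \<open>v\<close>; the two connecting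
      walks cancel.\<close>
    obtain \<sigma> where \<sigma>: "walk A S J q \<sigma>" "sum_list \<sigma> = p - q"
      using walk_connect[OF assms(2,1) agree_refl] by blast
    obtain u' where u': "cycle p u'" "sum_list u' = - sum_list u"
      using cycle_back[of p u] u(1,2) unfolding cycle_def by blast
    obtain v' where v': "cycle q v'" "sum_list v' = - sum_list v"
      using cycle_back[of q v] v(1,2) unfolding cycle_def by blast
    have ag: "agree J p (p + sum_list u')" using u'(1) by (simp add: cycle_def agree_def)
    obtain \<rho> where \<rho>: "walk A S J (p + sum_list u') \<rho>" "sum_list \<rho> = q - p"
      using walk_connect[OF assms(1,2) ag] by blast
    have sum: "sum_list (\<sigma> @ u' @ \<rho>) = - sum_list u" using \<sigma>(2) u'(2) \<rho>(2) by simp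
    have "walk A S J q (\<sigma> @ u' @ \<rho>)"
      using \<sigma> u'(1) \<rho>(1) by (simp add: walk_append cycle_def)
    then have "cycle q (\<sigma> @ u' @ \<rho>)" using u(2) unfolding cycle_def sum by (simp add: agree_def)
    from cycle_append[OF this v'(1)] have cyc: "cycle q ((\<sigma> @ u' @ \<rho>) @ v')" .
    have sum': "sum_list ((\<sigma> @ u' @ \<rho>) @ v') = - sum_list u - sum_list v"
      using sum v'(2) by (simp add: add.assoc)
    have "\<bar>sum_list ((\<sigma> @ u' @ \<rho>) @ v') $ k\<bar> \<le> int W" for k
      unfolding sum' W_def using u_abs[of k] v_abs[of k] by simp
    from short_cycle[OF assms(2) cyc this] sum' show ?thesis
      by (auto intro!: that simp: F_def)
  qed
  have m\<pi>: "int (a * length \<pi>) \<le> int m" and m\<theta>: "int (a * length \<theta>) \<le> int m"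
    unfolding of_nat_le_iff m_def using \<pi>(3) \<theta>(3) by simp_all
  define x1 x2 x3 where "x1 = p + int m *s sum_list u" and "x2 = x1 + sum_list \<pi>"
    and "x3 = x2 + int m *s sum_list \<theta>"
  have x2: "x2 = q + int m *s sum_list u" by (simp add: x2_def x1_def \<pi>(2))
  have x3: "x3 = q - int m *s sum_list v"
    by (simp add: x3_def x2 \<theta>(2) vec_eq_iff algebra_simps)
  have pq0: "0 \<le> p $ i" "0 \<le> q $ i" if "i \<in> C" for i using nonneg assms(1,2) that by auto
  have u0: "0 \<le> sum_list u $ i" and v0: "sum_list v $ i \<le> 0" if "i \<in> C" for i
    using u_gain[of i] v_gain[of i] uJ[of i] vJ[of i] that by (cases "i \<in> J"; simp)+
  have f1: "fires C p (concat (replicate m u))"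
  proof (rule fires_repeat)
    show "fires C (p + int j *s sum_list u) u" if "j < m" for j
      using u0 by (intro fires_mono[OF u(3)]) simp
  qed (rule pq0)
  have f2: "fires C x1 \<pi>"
  proof (rule walk_fires(1)[where B = J and c = 0])
    have "agree J p x1" using uJ by (simp add: agree_def x1_def)
    from walk_agree[OF this] \<pi>(1) show "walk A S J x1 \<pi>" by blast
    show "int (0 + a * length \<pi>) \<le> x1 $ i" if "i \<in> C - J" for i
    proof -
      have "int m * 1 \<le> int m * sum_list u $ i" using u_gain[OF that] by (intro mult_left_mono) auto
      with m\<pi> pq0(1)[of i] that show ?thesis by (simp add: x1_def)
    qed
  qed
  have f3: "fires C x2 (concat (replicate m \<theta>))"
  proof (rule fires_repeat)
    show "fires C (x2 + int j *s sum_list \<theta>) \<theta>" if "j < m" for j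
    proof (rule walk_fires(1)[where B = J and c = 0])
      have "agree J q (x2 + int j *s sum_list \<theta>)"
        using uJ vJ by (simp add: agree_def x2 \<theta>(2))
      from walk_agree[OF this] \<theta>(1) show "walk A S J (x2 + int j *s sum_list \<theta>) \<theta>"
        unfolding cycle_def by blast
      show "int (0 + a * length \<theta>) \<le> (x2 + int j *s sum_list \<theta>) $ i" if "i \<in> C - J" for i
      proof -
        \<comment> \<open>Between the rounds of \<open>\<theta>\<close> the gain of \<open>u\<close>
          is exchanged for that of \<open>v\<close>: after \<open>j\<close> rounds,
          \<open>m - j\<close> copies of the first and \<open>j\<close> of the second are present,
          each at least 1, so \<open>m\<close> units are always available.\<close>
        have "int (m - j) * 1 \<le> int (m - j) * sum_list u $ i"
          using u_gain[OF that] by (intro mult_left_mono) auto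
        moreover have "int j * 1 \<le> int j * (- sum_list v $ i)"
          using v_gain[OF that] by (intro mult_left_mono) auto
        moreover have "(x2 + int j *s sum_list \<theta>) $ i
            = q $ i + int (m - j) * sum_list u $ i + int j * (- sum_list v $ i)"
          using \<open>j < m\<close> by (simp add: x2 \<theta>(2) of_nat_diff algebra_simps)
        moreover have "int (m - j) + int j = int m" using \<open>j < m\<close> by simp
        moreover have "0 \<le> q $ i" using pq0(2) that by blast
        ultimately show ?thesis using m\<theta> by linarith
      qed
    qed
    show "0 \<le> x2 $ i" if "i \<in> C" for i
      using pq0(2) u0 that by (simp add: x2)
  qed
  have f4: "fires C x3 (concat (replicate m v))"
  proof (rule fires_repeat)
    show "fires C (x3 + int j *s sum_list v) v" if "j < m" for j
    \<comment> \<open>The last copy of \<open>v\<close> starts at \<open>q - sum_list v\<close>,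
      where it can be fired; the earlier copies start at least as high on \<open>C\<close>.\<close>
    proof (rule fires_mono[OF v(3)])
      fix i assume "i \<in> C"
      have "0 \<le> int (m - j - 1) * (- sum_list v $ i)" using v0[OF \<open>i \<in> C\<close>]
        by (intro mult_nonneg_nonneg) auto
      moreover have "(x3 + int j *s sum_list v) $ i
          = (q - sum_list v) $ i + int (m - j - 1) * (- sum_list v $ i)"
        using that by (simp add: x3 of_nat_diff algebra_simps)
      ultimately show "(q - sum_list v) $ i \<le> (x3 + int j *s sum_list v) $ i" by simp
    qed
    show "0 \<le> x3 $ i" if "i \<in> C" for i
    proof -
      have "int m * sum_list v $ i \<le> 0" using v0[OF that] by (intro mult_nonneg_nonpos) auto
      with pq0(2)[OF that] show ?thesis by (simp add: x3)
    qed
  qed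
  let ?\<sigma> = "concat (replicate m u) @ \<pi> @ concat (replicate m \<theta>) @ concat (replicate m v)"
  have "fires C p ?\<sigma>"
    using f1 f2 f3 f4 by (simp add: fires_append sum_list_repeat x3_def x2_def x1_def)
  moreover have "?\<sigma> \<in> lists A"
    using walk_lists[OF u(1)] walk_lists[OF v(1)] walk_lists[OF \<pi>(1)] \<theta>(1) walk_lists[of A S J q \<theta>]
    by (auto simp: cycle_def)
  moreover have "sum_list ?\<sigma> = q - p"
    by (simp add: sum_list_repeat \<pi>(2) \<theta>(2) vec_eq_iff algebra_simps)
  moreover have "length ?\<sigma> \<le> run_bound CARD('d) s a (card J)"
  proof -
    have "length ?\<sigma> = m * (length u + length v + length \<theta>) + length \<pi>"
      by (simp add: length_repeat algebra_simps)
    also have "\<dots> \<le> m * (2 * U + F) + F"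
      using u(5) v(5) \<theta>(3) \<pi>(3) by (intro add_mono mult_le_mono2) auto
    also have "\<dots> = run_bound CARD('d) s a (card J)"
      unfolding run_bound_def Let_def m_def F_def W_def U_def N_def ..
    finally show ?thesis .
  qed
  ultimately show ?thesis
    using card_J by blast
qed

end

section \<open>The length bound\<close>

text \<open>The telescoped recursion, which lets one threshold control the whole sum
  \<open>U\<close> in \<open>run_bound_le\<close>.\<close>

lemma lam_eq_sum: "lam s a m = s + 1 + a * (\<Sum>i<m. lam s a i ^ i)"
  by (induction m) (simp_all add: algebra_simps)

lemma Suc_power_le: "1 \<le> k \<Longrightarrow> Suc (k ^ k) \<le> Suc k ^ k"
  by (rule Suc_leI) (simp add: power_strict_mono)

lemma lam_step_le: "lam s a (Suc m) \<le> (1 + a) * lam s a m ^ m" if "1 \<le> m"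
proof -
  have "lam s a m ^ 1 \<le> lam s a m ^ m"
    using that lam_ge[of s a m] by (intro power_increasing) auto
  then show ?thesis by simp
qed

text \<open>In each step the factor \<open>1 + a\<close> costs one further power of
  \<open>x\<close>, so the exponent becomes \<open>1 + Suc m ^ Suc m\<close>, which is still at most
  \<open>Suc (Suc m) ^ Suc m\<close>.\<close>

lemma lam_le_power:
  fixes s a :: nat
  defines "x \<equiv> (1 + 2 * a) * (1 + s)"
  shows "lam s a (Suc m) \<le> x ^ (Suc m ^ m)"
proof (induction m)
  case 0
  show ?case by (simp add: x_def algebra_simps)
next
  case (Suc m)
  have "lam s a (Suc (Suc m)) \<le> (1 + a) * lam s a (Suc m) ^ Suc m"
    by (rule lam_step_le) simp
  also have "\<dots> \<le> x * (x ^ (Suc m ^ m)) ^ Suc m"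
    by (intro mult_le_mono power_mono Suc) (auto simp: x_def)
  also have "\<dots> = x ^ Suc (Suc m ^ Suc m)"
    by (simp only: power_Suc2[of "Suc m" m] power_Suc[of x] power_mult)
  also have "\<dots> \<le> x ^ (Suc (Suc m) ^ Suc m)"
    by (intro power_increasing Suc_power_le) (auto simp: x_def)
  finally show ?case .
qed

lemma eleven_mult_le: "1 \<le> d \<Longrightarrow> 11 * d \<le> (6::nat) ^ (d + 1)"
  by (induction d rule: dec_induct) auto

text \<open>All quantities are bounded by powers of \<open>x\<close>, with \<open>D = d ^ d\<close>:
  \<open>N\<close> by the power \<open>D\<close>, \<open>U\<close> by \<open>D + 1\<close>, the
  number \<open>k\<close> of inserted cycles by \<open>e\<close>. Then \<open>F\<close> is at most
  \<open>2 * E\<close> and the total at most \<open>10 * (x * (E * E))\<close>.\<close>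

lemma run_bound_le:
  fixes a s d n :: nat
  assumes "1 \<le> a" "1 \<le> s" "1 \<le> d" "n \<le> d"
  defines "x \<equiv> (1 + 2 * a) * (1 + s)"
  shows "run_bound d s a n \<le> 17 * d ^ 2 * x ^ (15 * d ^ (d + 2))"
proof -
  define U where "U = (\<Sum>i\<le>d. lam s a i ^ i)"
  define N where "N = lam s a n ^ n"
  define F where "F = N + cycle_bound d a N (s + 2 * a * U)"
  define D where "D = d ^ d"
  \<comment> \<open>\<open>y\<close> equals \<open>lam s a (Suc d)\<close> and dominates
    \<open>s\<close>, \<open>U\<close> and \<open>a * N\<close> at once.\<close>
  define y where "y = s + 1 + a * U"
  define k where "k = (2 * (d * (a * N) + (s + 2 * a * U + a * (N * (N + 1)))) + 1) ^ d"
  define e where "e = (2 * D + d + 2) * d"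
  define E where "E = x ^ (D + e)"
  have "3 * 2 \<le> (1 + 2 * a) * (1 + s)" using assms(1,2) by (intro mult_le_mono) auto
  then have x6: "6 \<le> x" by (simp add: x_def)
  have ax: "1 + a \<le> x" by (simp add: x_def)
  obtain d' where d': "d = Suc d'" using assms(3) by (cases d) auto
  have D1: "1 \<le> D" using assms(3) by (simp add: D_def)
  have "lam s a d ^ d \<le> (x ^ (Suc d' ^ d')) ^ d"
    using lam_le_power[of s a d'] unfolding d' x_def by (rule power_mono) simp
  moreover have "Suc d' ^ d' * d = D" by (simp add: D_def d')
  ultimately have Ld: "lam s a d ^ d \<le> x ^ D" by (metis power_mult)
  have "N \<le> lam s a d ^ n" unfolding N_def by (intro power_mono lam_mono assms) simp
  also have "\<dots> \<le> lam s a d ^ d" using lam_ge[of s a d] assms(4) by (intro power_increasing) auto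
  finally have ND: "N \<le> x ^ D" using Ld by linarith
  have y_lam: "y = lam s a (Suc d)"
    using lam_eq_sum[of s a "Suc d"] by (simp add: y_def U_def lessThan_Suc_atMost)
  have "y \<le> (1 + a) * lam s a d ^ d" unfolding y_lam by (rule lam_step_le[OF assms(3)])
  also have "\<dots> \<le> x * x ^ D" using ax Ld by (rule mult_le_mono)
  finally have yD: "y \<le> x ^ (D + 1)" by simp
  have N1: "1 \<le> N" using lam_ge[of s a n] by (simp add: N_def)
  have "N \<le> U" unfolding N_def U_def using assms(4) by (intro member_le_sum) auto
  then have aNU: "a * N \<le> a * U" by simp
  have "1 * U \<le> a * U" using assms(1) by (rule mult_le_mono1)
  then have Uy: "U \<le> y" unfolding y_def by linarith
  have "2 * (d * (a * N) + (s + 2 * a * U + a * (N * (N + 1)))) + 1 \<le> 11 * d * (y * N)"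
  proof -
    have aN: "a * N \<le> y" using aNU unfolding y_def by linarith
    have yN: "y \<le> y * N" using N1 by simp
    have 1: "d * (a * N) \<le> d * (y * N)" using aN yN by (intro mult_le_mono2) linarith
    have "a * (N * (N + 1)) = (a * N) * (N + 1)" by (simp only: mult.assoc)
    also have "\<dots> \<le> y * (2 * N)" using aN N1 by (intro mult_le_mono) auto
    finally have 2: "a * (N * (N + 1)) \<le> 2 * (y * N)" by simp
    have 3: "s + 2 * a * U + 1 \<le> 2 * (y * N)" using yN by (simp add: y_def)
    have 4: "1 * (y * N) \<le> d * (y * N)" using assms(3) by (intro mult_le_mono1)
    have "2 * (d * (a * N) + (s + 2 * a * U + a * (N * (N + 1)))) + 1
        \<le> 2 * (d * (a * N)) + 2 * (s + 2 * a * U + 1) + 2 * (a * (N * (N + 1)))"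
      unfolding distrib_left[of 2] by simp
    also have "\<dots> \<le> 2 * (d * (y * N)) + 2 * (2 * (y * N)) + 2 * (2 * (y * N))"
      by (intro add_mono mult_le_mono2 1 2 3)
    also have "\<dots> = 2 * (d * (y * N)) + 8 * (y * N)" by simp
    also have "\<dots> \<le> 11 * (d * (y * N))" using 4 by linarith
    finally show ?thesis by (simp add: mult.assoc)
  qed
  also have "\<dots> \<le> x ^ (d + 1) * (x ^ (D + 1) * x ^ D)"
  proof (intro mult_le_mono yD ND)
    \<comment> \<open>As \<open>x\<close> is at least 6, the numerical factor is absorbed by
      \<open>d + 1\<close> powers of \<open>x\<close>.\<close>
    have "11 * d \<le> 6 ^ (d + 1)" by (rule eleven_mult_le[OF assms(3)])
    also have "(6::nat) ^ (d + 1) \<le> x ^ (d + 1)" using x6 by (rule power_mono) simp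
    finally show "11 * d \<le> x ^ (d + 1)" .
  qed
  also have "\<dots> = x ^ (2 * D + d + 2)" by (simp add: mult_2 add_ac flip: power_add power_Suc)
  finally have "k \<le> (x ^ (2 * D + d + 2)) ^ d" unfolding k_def by (rule power_mono) simp
  then have ke: "k \<le> x ^ e" unfolding e_def by (simp only: power_mult)
  have De: "D + 1 \<le> e"
  proof -
    have "(D + 1) * 1 \<le> (2 * D + d + 2) * d" using assms(3) by (intro mult_le_mono) auto
    then show ?thesis by (simp add: e_def)
  qed
  have "N + 2 \<le> x ^ e"
  proof -
    have "1 \<le> x ^ D" using x6 by simp
    then have "N + 2 \<le> 6 * x ^ D" using ND by linarith
    also have "\<dots> \<le> x * x ^ D" using x6 by (rule mult_le_mono1)
    also have "\<dots> = x ^ (D + 1)" by simp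
    also have "\<dots> \<le> x ^ e" using x6 De by (intro power_increasing) auto
    finally show ?thesis .
  qed
  have "F = N * (N + 2 + k)" by (simp add: F_def cycle_bound_def k_def algebra_simps)
  also have "\<dots> \<le> x ^ D * (x ^ e + x ^ e)"
    using ND \<open>N + 2 \<le> x ^ e\<close> ke by (intro mult_le_mono) linarith+
  finally have FE: "F \<le> 2 * E" by (simp add: E_def power_add algebra_simps)
  have "U \<le> x ^ (D + 1)" using Uy yD by linarith
  also have "\<dots> \<le> E" unfolding E_def using x6 De by (intro power_increasing) auto
  finally have UE: "U \<le> E" .
  have E1: "1 \<le> E" using x6 by (simp add: E_def)
  have "1 * E \<le> (x * E) * E" using x6 E1 by (intro mult_le_mono1) simp
  then have "x * (2 * E) * (2 * E + 2 * E) + 2 * E \<le> 10 * (x * (E * E))" by simp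
  moreover have "a * F * (2 * U + F) + F \<le> x * (2 * E) * (2 * E + 2 * E) + 2 * E"
    using FE UE ax by (intro add_mono mult_le_mono) auto
  ultimately have "a * F * (2 * U + F) + F \<le> 10 * (x * (E * E))" by linarith
  also have "x * (E * E) = x ^ (1 + 2 * (D + e))"
    by (simp add: E_def mult_2 power_add)
  also have "10 * x ^ (1 + 2 * (D + e)) \<le> (17 * d ^ 2) * x ^ (15 * d ^ (d + 2))"
  proof (rule mult_le_mono)
    have "1 \<le> d ^ 2" using assms(3) by simp
    then show "10 \<le> 17 * d ^ 2" by linarith
    define Z where "Z = d ^ (d + 2)"
    have Z: "Z = D * d * d" by (simp add: Z_def D_def power2_eq_square power_add)
    have dd: "1 \<le> d * d" using assms(3) by (cases d) auto
    have "1 * 1 \<le> D * (d * d)" using D1 dd by (rule mult_le_mono)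
    moreover have "D * 1 \<le> D * (d * d)" using dd by (rule mult_le_mono2)
    moreover have "D * d * 1 \<le> D * d * d" using assms(3) by (rule mult_le_mono2)
    moreover have "1 * (d * d) \<le> D * (d * d)" using D1 by (rule mult_le_mono1)
    moreover have "d * 1 \<le> d * d" using assms(3) by (rule mult_le_mono2)
    ultimately have "1 \<le> Z" "D \<le> Z" "D * d \<le> Z" "d * d \<le> Z" "d \<le> Z"
      unfolding Z by simp_all
    \<comment> \<open>Each monomial is at most \<open>Z\<close>, and the coefficients add up to
      13.\<close>
    moreover have "1 + 2 * (D + e) = 1 + 2 * D + 4 * (D * d) + 2 * (d * d) + 4 * d"
      by (simp add: e_def algebra_simps)
    ultimately have "1 + 2 * (D + e) \<le> 15 * Z" by linarith
    then show "x ^ (1 + 2 * (D + e)) \<le> x ^ (15 * d ^ (d + 2))"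
      using x6 unfolding Z_def by (intro power_increasing) auto
  qed
  finally show ?thesis unfolding run_bound_def Let_def U_def N_def F_def .
qed

section \<open>Configurations with stars\<close>

lemma abs_component_le_star_norm: "p $ i = Some n \<Longrightarrow> nat \<bar>n\<bar> \<le> star_norm p"
  for p :: "'d::finite starvec"
proof -
  assume *: "p $ i = Some n"
  then have "i \<in> - stars p" by (simp add: stars_def)
  then have "stars p \<noteq> UNIV" "nat \<bar>the (p $ i)\<bar> \<in> (\<lambda>i. nat \<bar>the (p $ i)\<bar>) ` (- stars p)"
    by auto
  then show ?thesis unfolding star_norm_def using * by (auto intro!: Max_ge)
qed

lemma abs_component_le_vec_norm: "\<bar>v $ i\<bar> \<le> int (vec_norm v)"
  using abs_component_le_star_norm[of "of_vec v" i "v $ i"]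
  by (simp add: vec_norm_def of_vec_def)

lemma abs_component_le_set_norm: "finite A \<Longrightarrow> v \<in> A \<Longrightarrow> \<bar>v $ i\<bar> \<le> int (set_norm A)"
proof -
  assume "finite A" "v \<in> A"
  then have "vec_norm v \<le> set_norm A" by (auto simp: set_norm_def intro!: Max_ge)
  with abs_component_le_vec_norm[of v i] show ?thesis by simp
qed

text \<open>Links starred configurations to integer vectors. The entries in \<open>I\<close> are
  arbitrary and merely record displacements.\<close>

definition star_vec :: "'d::finite set \<Rightarrow> int ^ 'd \<Rightarrow> 'd starvec" where
  "star_vec I x = (\<chi> i. if i \<in> I then None else Some (x $ i))"

lemma star_vec_Nstar: "star_vec I x \<in> Nstar I \<longleftrightarrow> (\<forall>i\<in>- I. 0 \<le> x $ i)"
  by (auto simp: star_vec_def Nstar_def Zstar_def stars_def)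

lemma star_vec_add: "star_vec I x \<oplus>\<^sub>\<star> proj I (of_vec v) = star_vec I (x + v)"
  by (simp add: star_vec_def star_add_def proj_def of_vec_def vec_eq_iff)

lemma star_vec_exists: "p \<in> Nstar I \<Longrightarrow> \<exists>x. p = star_vec I x"
  by (intro exI[of _ "\<chi> i. the (p $ i)"])
    (auto simp: star_vec_def Nstar_def Zstar_def stars_def vec_eq_iff)

lemma stars_star_vec [simp]: "stars (star_vec I x) = I"
  by (auto simp: star_vec_def stars_def)

text \<open>The set of stars is constant along a run and equals that of its start, and the start and
  the label determine all configurations of the run.\<close>

lemma run_iff_fires:
  "run (star_vec I x) \<sigma> y \<longleftrightarrow> fires (- I) x \<sigma> \<and> y = star_vec I (x + sum_list \<sigma>)"
proof
  assume "run (star_vec I x) \<sigma> y"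
  then obtain I' c where c: "\<And>j. j \<le> length \<sigma> \<Longrightarrow> c j \<in> Nstar I'" "c 0 = star_vec I x"
    "c (length \<sigma>) = y" "\<And>j. j < length \<sigma> \<Longrightarrow> c (Suc j) = c j \<oplus>\<^sub>\<star> proj I' (of_vec (\<sigma> ! j))"
    unfolding run_def by blast
  have [simp]: "I' = I" using c(1)[of 0] c(2) by (simp add: Nstar_def Zstar_def)
  have cj: "c j = star_vec I (x + sum_list (take j \<sigma>))" if "j \<le> length \<sigma>" for j
    using that
  proof (induction j)
    case 0
    then show ?case using c(2) by simp
  next
    case (Suc j)
    then show ?case
      using c(4)[of j] by (simp add: star_vec_add take_Suc_conv_app_nth add.assoc)
  qed
  then have "fires (- I) x \<sigma>"
    using c(1) unfolding fires_def by (metis \<open>I' = I\<close> star_vec_Nstar)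
  with cj[of "length \<sigma>"] c(3) show "fires (- I) x \<sigma> \<and> y = star_vec I (x + sum_list \<sigma>)" by simp
next
  assume *: "fires (- I) x \<sigma> \<and> y = star_vec I (x + sum_list \<sigma>)"
  let ?c = "\<lambda>j. star_vec I (x + sum_list (take j \<sigma>))"
  have "?c j \<in> Nstar I" if "j \<le> length \<sigma>" for j
    using * that unfolding star_vec_Nstar fires_def by blast
  moreover have "?c (Suc j) = ?c j \<oplus>\<^sub>\<star> proj I (of_vec (\<sigma> ! j))" if "j < length \<sigma>" for j
    using that by (simp add: star_vec_add take_Suc_conv_app_nth add.assoc)
  ultimately show "run (star_vec I x) \<sigma> y"
    unfolding run_def using * by (intro exI[of _ I] exI[of _ ?c]) simp
qed

section \<open>Mutually reachable configurations\<close>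

text \<open>The return to \<open>p\<close> is exact in all components, including those outside
  \<open>C\<close>; this encodes that the displacements of the two words cancel.\<close>

definition component :: "(int ^ 'd) set \<Rightarrow> 'd set \<Rightarrow> int ^ 'd \<Rightarrow> (int ^ 'd) set" where
  "component A C p = {y. (\<exists>\<sigma>\<in>lists A. fires C p \<sigma> \<and> p + sum_list \<sigma> = y)
     \<and> (\<exists>\<tau>\<in>lists A. fires C y \<tau> \<and> y + sum_list \<tau> = p)}"

lemma fires_start: "fires C x \<sigma> \<Longrightarrow> i \<in> C \<Longrightarrow> 0 \<le> x $ i"
  by (cases \<sigma>) (auto simp: fires_Cons fires_Nil)

text \<open>The intermediate configuration is reached from \<open>p\<close> through \<open>x\<close>
  and leads back to \<open>p\<close> through \<open>y\<close>.\<close>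

lemma component_between:
  assumes "x \<in> component A C p" "y \<in> component A C p"
    and "\<sigma> \<in> lists A" "fires C x \<sigma>" "\<tau> \<in> lists A" "fires C (x + sum_list \<sigma>) \<tau>"
    and "x + sum_list \<sigma> + sum_list \<tau> = y"
  shows "x + sum_list \<sigma> \<in> component A C p"
proof -
  obtain \<mu> where \<mu>: "\<mu> \<in> lists A" "fires C p \<mu>" "p + sum_list \<mu> = x"
    using assms(1) unfolding component_def by blast
  obtain \<nu> where \<nu>: "\<nu> \<in> lists A" "fires C y \<nu>" "y + sum_list \<nu> = p"
    using assms(2) unfolding component_def by blast
  have "fires C p (\<mu> @ \<sigma>)" "p + sum_list (\<mu> @ \<sigma>) = x + sum_list \<sigma>"
    using \<mu> assms(4) by (auto simp: fires_append simp flip: add.assoc)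
  moreover have "fires C (x + sum_list \<sigma>) (\<tau> @ \<nu>)"
    using assms(6,7) \<nu>(2) by (simp add: fires_append)
  moreover have "x + sum_list \<sigma> + sum_list (\<tau> @ \<nu>) = p"
    using assms(7) \<nu>(3) by (simp flip: add.assoc)
  moreover have "\<mu> @ \<sigma> \<in> lists A" "\<tau> @ \<nu> \<in> lists A" using \<mu> \<nu> assms(3,5) by simp_all
  ultimately show ?thesis unfolding component_def by blast
qed

lemma walk_in_component:
  assumes "x \<in> component A C p" "\<sigma> \<in> lists A" "fires C x \<sigma>" "x + sum_list \<sigma> \<in> component A C p"
  shows "walk A (component A C p) UNIV x \<sigma>"
  using assms
proof (induction \<sigma> arbitrary: x)
  case Nil
  then show ?case by simp
next
  case (Cons v \<sigma>)
  have f: "v \<in> A" "\<sigma> \<in> lists A" "fires C x [v]" "fires C (x + v) \<sigma>"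
    using Cons.prems(2,3) fires_append[of C x "[v]" \<sigma>] by auto
  have "x + sum_list [v] \<in> component A C p"
    by (rule component_between[OF Cons.prems(1,4), of "[v]" \<sigma>])
      (use f in \<open>simp_all add: add.assoc\<close>)
  then have xv: "x + v \<in> component A C p" by simp
  from Cons.IH[OF xv] f Cons.prems(4) have "walk A (component A C p) UNIV (x + v) \<sigma>"
    by (simp add: add.assoc)
  with xv f(1) Cons.prems(1) show ?case by simp
qed

lemma strongly_connected_component:
  assumes "\<And>v i. v \<in> A \<Longrightarrow> \<bar>v $ i\<bar> \<le> int a"
  shows "strongly_connected A (component A C p) C a"
proof
  fix x y assume xy: "x \<in> component A C p" "y \<in> component A C p"
  obtain \<mu> where \<mu>: "\<mu> \<in> lists A" "fires C x \<mu>" "x + sum_list \<mu> = p"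
    using xy(1) unfolding component_def by blast
  obtain \<nu> where \<nu>: "\<nu> \<in> lists A" "fires C p \<nu>" "p + sum_list \<nu> = y"
    using xy(2) unfolding component_def by blast
  have "fires C x (\<mu> @ \<nu>)" "x + sum_list (\<mu> @ \<nu>) = y" "\<mu> @ \<nu> \<in> lists A"
    using \<mu> \<nu> by (auto simp: fires_append simp flip: add.assoc)
  with walk_in_component[OF xy(1)] xy(2)
  show "\<exists>\<sigma>. walk A (component A C p) UNIV x \<sigma> \<and> x + sum_list \<sigma> = y" by metis
next
  fix y i assume "y \<in> component A C p" "i \<in> C"
  then obtain \<tau> where "fires C y \<tau>" unfolding component_def by blast
  then show "0 \<le> y $ i" using \<open>i \<in> C\<close> by (rule fires_start)
qed (rule assms)

text \<open>Uses \<open>short_run\<close> with \<open>s = b + c\<close>, which bounds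
  \<open>p\<close> and \<open>p + sum_list \<alpha>\<close> on \<open>C\<close> as well as their
  difference. For displacement 0 the empty word will do; otherwise \<open>a\<close> and
  \<open>b + c\<close> are at least 1, as \<open>run_bound_le\<close> demands.\<close>

lemma short_fireable_word:
  fixes A :: "(int ^ 'd::finite) set"
  assumes A: "\<And>v i. v \<in> A \<Longrightarrow> \<bar>v $ i\<bar> \<le> int a"
    and words: "\<alpha> \<in> lists A" "\<beta> \<in> lists A"
    and fires: "fires C p (\<alpha> @ \<beta>)" and sum: "sum_list \<alpha> + sum_list \<beta> = 0"
    and p_le: "\<And>i. i \<in> C \<Longrightarrow> p $ i \<le> int b" and \<alpha>_le: "\<And>i. \<bar>sum_list \<alpha> $ i\<bar> \<le> int c"
  shows "\<exists>\<gamma>\<in>lists A. fires C p \<gamma> \<and> sum_list \<gamma> = sum_list \<alpha> \<and>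
    length \<gamma> \<le> 17 * CARD('d) ^ 2 * ((1 + 2 * a) * (1 + b + c)) ^ (15 * CARD('d) ^ (CARD('d) + 2))"
proof (cases "sum_list \<alpha> = 0")
  case True
  have "fires C p []" using fires_start[OF fires] by (simp add: fires_Nil)
  with True show ?thesis by (intro bexI[of _ "[]"]) simp_all
next
  case False
  obtain k where k: "sum_list \<alpha> $ k \<noteq> 0" using False by (auto simp: vec_eq_iff)
  have c: "1 \<le> b + c" using \<alpha>_le[of k] k by simp
  have a: "1 \<le> a"
  proof (rule ccontr)
    assume "\<not> 1 \<le> a"
    then have "a = 0" by simp
    have "\<bar>sum_list \<alpha> $ k\<bar> \<le> int (a * length \<alpha>)"
      using words(1) A by (intro abs_sum_list_le) auto
    with \<open>a = 0\<close> k show False by simp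
  qed
  define q where "q = p + sum_list \<alpha>"
  have f: "fires C p \<alpha>" "fires C q \<beta>" "q + sum_list \<beta> = p"
    using fires sum by (auto simp: fires_append q_def add.assoc)
  have "fires C p []" using fires_start[OF fires] by (simp add: fires_Nil)
  then have p: "p \<in> component A C p"
    unfolding component_def by (auto intro!: bexI[of _ "[]"])
  have q: "q \<in> component A C p"
    unfolding component_def mem_Collect_eq
    using f words q_def by (intro conjI bexI[of _ \<alpha>] bexI[of _ \<beta>]) simp_all
  have p_le': "p $ i \<le> int (b + c)" if "i \<in> C" for i
    using p_le[OF that] by simp
  have q_le: "q $ i \<le> int (b + c)" if "i \<in> C" for i
    using p_le[OF that] \<alpha>_le[of i] by (simp add: q_def)
  have qp_le: "\<bar>(q - p) $ i\<bar> \<le> int (b + c)" for i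
    using \<alpha>_le[of i] by (simp add: q_def)
  obtain \<gamma> n where \<gamma>: "\<gamma> \<in> lists A" "fires C p \<gamma>" "sum_list \<gamma> = q - p"
    and n: "n \<le> CARD('d)" "length \<gamma> \<le> run_bound CARD('d) (b + c) a n"
    using strongly_connected.short_run[OF strongly_connected_component[OF A] p q p_le' q_le qp_le]
    by blast
  have "1 \<le> CARD('d)" by (simp add: Suc_le_eq)
  from order.trans[OF n(2) run_bound_le[OF a c this n(1)]] \<gamma> show ?thesis
    by (intro bexI[of _ \<gamma>]) (simp_all add: q_def add.assoc)
qed

theorem theorem10p1:
  fixes A :: "(int ^ 'd::finite) set"
    and p :: "'d starvec"
    and \<alpha> :: "(int ^ 'd) list"
    and d x :: nat
  assumes "finite A"
    and "configuration p"
    and "\<alpha> \<in> lists A"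
    and "reversible A p \<alpha>"
  defines "d \<equiv> CARD('d)"
    and "x \<equiv> (1 + 2 * set_norm A) * (1 + star_norm p + vec_norm (displacement \<alpha>))"
  shows "\<exists>\<alpha>'\<in>lists A. reversible A p \<alpha>' \<and> displacement \<alpha>' = displacement \<alpha> \<and>
           length \<alpha>' \<le> 17 * d ^ 2 * x ^ (15 * d ^ (d + 2))"
proof -
  obtain I where "p \<in> Nstar I" using assms(2) unfolding configuration_def by blast
  then obtain P where p: "p = star_vec I P" using star_vec_exists by blast
  obtain \<beta> where \<beta>: "\<beta> \<in> lists A" "fires (- I) P (\<alpha> @ \<beta>)" "sum_list \<alpha> + sum_list \<beta> = 0"
    using assms(4) unfolding reversible_def p run_iff_fires displacement_def by blast
  have "P $ i \<le> int (star_norm p)" if "i \<in> - I" for i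
    using abs_component_le_star_norm[of p i "P $ i"] that by (simp add: p star_vec_def)
  from short_fireable_word[OF abs_component_le_set_norm[OF assms(1)] assms(3) \<beta> this
      abs_component_le_vec_norm]
  obtain \<gamma> where \<gamma>: "\<gamma> \<in> lists A" "fires (- I) P \<gamma>" "sum_list \<gamma> = sum_list \<alpha>"
    "length \<gamma> \<le> 17 * d ^ 2 * x ^ (15 * d ^ (d + 2))"
    unfolding x_def d_def displacement_def by blast
  \<comment> \<open>\<open>\<gamma>\<close> ends at the same integer vector as
    \<open>\<alpha>\<close>, so \<open>\<beta>\<close> leads back from there as well.\<close>
  have "reversible A p \<gamma>"
    unfolding reversible_def p run_iff_fires displacement_def
    using \<gamma> \<beta> by (intro bexI[of _ \<beta>]) (simp_all add: fires_append)
  with \<gamma> show ?thesis unfolding displacement_def by blast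
qed

end
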